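(* Let $w[1:n]$ be a string and let $g_{rl}$ be the size of the smallest RLSLP generating $w$. Let $f$ be a function from strings to a set of size $n^{\mathcal{O}(1)}$ such that $f(xy)=h(f(x),f(y),|x|,|y|)$ for all strings $x,y$, where $h$ is a function computable in time $\mathcal{O}(T(h))$. Then it is possible to construct a data structure (index) of size $\mathcal{O}(g_{rl})$ that, given $1\le i\le j\le n$, computes $f(w[i:j])$ in $\mathcal{O}(T(h)\cdot\log n)$ time.
   Context: A run-length straight-line program (RLSLP) is a context-free grammar in which each variable has exactly one rule, variables can be ordered so that each rule's right-hand side mentions only terminals and strictly smaller variables, and the rules have one of the forms $A\rightarrow a$ ($a$ a terminal), $A\rightarrow A_1\cdots A_k$ ($k>1$ variables), or $A\rightarrow B^t$ with integer $t>2$ (deriving $t$ concatenated copies of the string derived by $B$); it generates the unique string derived by its start variable. Its size is the sum of the lengths of the right-hand sides, with a rule $A\rightarrow B^t$ counting as size 2. Space is measured in machine words of $\Theta(\log n)$ bits; $|x|$ denotes the length of string $x$. *)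

theory Defs
  imports Complex_Main
begin

section \<open>Run-length straight-line programs\<close>

datatype ('v, 'a) rhs = Term 'a | Cat "'v list" | Rep 'v nat

fun rhs_vars :: "('v, 'a) rhs \<Rightarrow> 'v set" where
  "rhs_vars (Term a) = {}"
| "rhs_vars (Cat Bs) = set Bs"
| "rhs_vars (Rep B t) = {B}"

fun rhs_ok :: "('v, 'a) rhs \<Rightarrow> bool" where
  "rhs_ok (Term a) \<longleftrightarrow> True"
| "rhs_ok (Cat Bs) \<longleftrightarrow> length Bs > 1"
| "rhs_ok (Rep B t) \<longleftrightarrow> t > 2"

fun rhs_size :: "('v, 'a) rhs \<Rightarrow> nat" where
  "rhs_size (Term a) = 1"
| "rhs_size (Cat Bs) = length Bs"
| "rhs_size (Rep B t) = 2"

text \<open>The field \<open>rule\<close> gives each variable its unique rule; its values outside \<open>vars\<close> are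
  irrelevant.\<close>

record ('v, 'a) grammar =
  vars :: "'v set"
  rule :: "'v \<Rightarrow> ('v, 'a) rhs"
  start :: 'v

definition rlslp :: "('v, 'a) grammar \<Rightarrow> bool" where
  "rlslp G \<longleftrightarrow> finite (vars G) \<and> start G \<in> vars G \<and>
     (\<forall>A\<in>vars G. rhs_ok (rule G A) \<and> rhs_vars (rule G A) \<subseteq> vars G) \<and>
     (\<exists>rank :: 'v \<Rightarrow> nat. inj_on rank (vars G) \<and>
        (\<forall>A\<in>vars G. \<forall>B\<in>rhs_vars (rule G A). rank B < rank A))"

inductive derives :: "('v, 'a) grammar \<Rightarrow> 'v \<Rightarrow> 'a list \<Rightarrow> bool" for G where
  derives_Term: "rule G A = Term a \<Longrightarrow> derives G A [a]"
| derives_Cat: "rule G A = Cat Bs \<Longrightarrow> list_all2 (derives G) Bs us \<Longrightarrow> derives G A (concat us)"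
| derives_Rep: "rule G A = Rep B t \<Longrightarrow> derives G B u \<Longrightarrow> derives G A (concat (replicate t u))"

definition generates :: "('v, 'a) grammar \<Rightarrow> 'a list \<Rightarrow> bool" where
  "generates G w \<longleftrightarrow> rlslp G \<and> derives G (start G) w"

definition rlslp_size :: "('v, 'a) grammar \<Rightarrow> nat" where
  "rlslp_size G = (\<Sum>A\<in>vars G. rhs_size (rule G A))"

text \<open>Variable sets are finite, so taking the variables from \<^typ>\<open>nat\<close> loses nothing. The minimum
  exists whenever \<open>w \<noteq> []\<close>, see \<open>generates_ex\<close> below.\<close>

definition g_rl :: "'a list \<Rightarrow> nat" where
  "g_rl w = (LEAST s. \<exists>G :: (nat, 'a) grammar. generates G w \<and> rlslp_size G = s)"

lemma derives_unique: "derives G A u \<Longrightarrow> derives G A v \<Longrightarrow> u = v"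
proof (induction arbitrary: v rule: derives.induct)
  case (derives_Term A a)
  from derives_Term(2,1) show ?case by (auto elim: derives.cases)
next
  case (derives_Cat A Bs us)
  from derives_Cat.prems obtain vs where v: "v = concat vs" and vs: "list_all2 (derives G) Bs vs"
    by (rule derives.cases) (use derives_Cat.hyps(1) in auto)
  have "us = vs"
  proof (rule nth_equalityI)
    show "length us = length vs"
      using list_all2_lengthD[OF vs] list_all2_lengthD[OF derives_Cat.IH] by simp
    fix i assume "i < length us"
    then have "i < length Bs" using list_all2_lengthD[OF derives_Cat.IH] by simp
    then show "us ! i = vs ! i"
      using list_all2_nthD[OF vs] list_all2_nthD[OF derives_Cat.IH] by blast
  qed
  then show ?case using v by simp
next
  case (derives_Rep A B t u)
  from derives_Rep.prems obtain u' where "v = concat (replicate t u')" "derives G B u'"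
    by (rule derives.cases) (use derives_Rep.hyps(1) in auto)
  then show ?case using derives_Rep.IH by blast
qed

lemma generates_ex:
  assumes "w \<noteq> []"
  shows "\<exists>G :: (nat, 'a) grammar. generates G (w :: 'a list)"
proof (cases "length w = 1")
  case True
  then obtain a where w: "w = [a]" by (auto simp: length_Suc_conv)
  let ?G = "\<lparr>vars = {0}, rule = (\<lambda>_. Term a), start = 0\<rparr> :: (nat, 'a) grammar"
  have "rlslp ?G" unfolding rlslp_def by simp
  moreover have "derives ?G (start ?G) [a]" by (rule derives_Term) simp
  ultimately show ?thesis unfolding generates_def w by blast
next
  case False
  let ?n = "length w"
  define R where "R A = (if A < ?n then Term (w ! A) else Cat [0..<?n])" for A
  define G :: "(nat, 'a) grammar" where "G = \<lparr>vars = {..?n}, rule = R, start = ?n\<rparr>"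
  have "length w \<noteq> 0" using assms by simp
  then have n: "?n > 1" using False by linarith
  have "rlslp G" unfolding rlslp_def
  proof (intro conjI exI[of _ id] ballI)
    fix A assume "A \<in> vars G"
    then have A: "A \<le> ?n" by (simp add: G_def)
    show "rhs_ok (rule G A)" using n by (simp add: G_def R_def)
    show "rhs_vars (rule G A) \<subseteq> vars G" by (auto simp: G_def R_def)
    fix B assume "B \<in> rhs_vars (rule G A)"
    then show "id B < id A" using A by (simp add: G_def R_def split: if_splits)
  qed (simp_all add: G_def)
  moreover have "derives G ?n (concat (map (\<lambda>a. [a]) w))"
  proof (rule derives_Cat)
    show "rule G ?n = Cat [0..<?n]" by (simp add: G_def R_def)
    show "list_all2 (derives G) [0..<?n] (map (\<lambda>a. [a]) w)"
      unfolding list_all2_conv_all_nth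
    proof (intro conjI allI impI)
      fix i assume "i < length [0..<?n]"
      then have i: "i < ?n" by simp
      have "derives G i [w ! i]" by (rule derives_Term) (simp add: G_def R_def i)
      then show "derives G ([0..<?n] ! i) (map (\<lambda>a. [a]) w ! i)" using i by simp
    qed simp
  qed
  ultimately have "generates G w" unfolding generates_def by (simp add: G_def)
  then show ?thesis by blast
qed


section \<open>A word RAM with subroutine calls\<close>

text \<open>Words of \<open>W\<close> bits are the naturals below \<open>2 ^ W\<close>; arithmetic is modulo \<open>2 ^ W\<close>.
  Programs are finite, hence use finitely many registers, and they do not depend on \<open>W\<close>, which
  is a parameter of the semantics.\<close>

datatype binop = Add | Sub | Mul | Div | Mod | And | Or | Xor | Shl | Shr | Less | Equal

fun eval_op :: "nat \<Rightarrow> binop \<Rightarrow> nat \<Rightarrow> nat \<Rightarrow> nat" where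
  "eval_op W Add a b = (a + b) mod 2 ^ W"
| "eval_op W Sub a b = nat ((int a - int b) mod 2 ^ W)"
| "eval_op W Mul a b = (a * b) mod 2 ^ W"
| "eval_op W Div a b = a div b"
| "eval_op W Mod a b = a mod b"
| "eval_op W And a b = Bit_Operations.and a b"
| "eval_op W Or a b = Bit_Operations.or a b"
| "eval_op W Xor a b = Bit_Operations.xor a b"
| "eval_op W Shl a b = push_bit b a mod 2 ^ W"
| "eval_op W Shr a b = drop_bit b a"
| "eval_op W Less a b = (if a < b then 1 else 0)"
| "eval_op W Equal a b = (if a = b then 1 else 0)"

type_synonym reg = nat

datatype com =
    Const reg nat
  | Move reg reg
  | Bin binop reg reg reg
  | Load reg reg
  | Store reg reg
  | Call reg reg reg reg reg
  | Seq com com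
  | If reg com com
  | While reg com

text \<open>A state consists of the registers and the memory.\<close>

type_synonym state = "(reg \<Rightarrow> nat) \<times> (nat \<Rightarrow> nat)"

definition cells :: "nat list \<Rightarrow> nat \<Rightarrow> nat" where
  "cells xs p = (if p < length xs then xs ! p else 0)"

text \<open>\<open>exec W sub c s t s'\<close>: with word size \<open>W\<close> and subroutine \<open>sub\<close>, program \<open>c\<close> takes state
  \<open>s\<close> to state \<open>s'\<close> in exactly \<open>t\<close> steps. Loads and stores address the memory through a register.
  \<open>Call d a b p q\<close> runs the subroutine on the contents of registers \<open>a, b, p, q\<close> in a private
  frame (its registers \<open>0,\<dots>,3\<close> hold the arguments, everything else is zero), copies its
  register \<open>0\<close> into \<open>d\<close>, and is charged for all of its steps. A subroutine itself runs with
  \<open>sub = None\<close>, so it must be a program without calls.\<close>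

inductive exec :: "nat \<Rightarrow> com option \<Rightarrow> com \<Rightarrow> state \<Rightarrow> nat \<Rightarrow> state \<Rightarrow> bool" for W where
  exec_Const: "exec W sub (Const d c) (r, m) 1 (r(d := c mod 2 ^ W), m)"
| exec_Move: "exec W sub (Move d a) (r, m) 1 (r(d := r a), m)"
| exec_Bin: "exec W sub (Bin f d a b) (r, m) 1 (r(d := eval_op W f (r a) (r b)), m)"
| exec_Load: "exec W sub (Load d a) (r, m) 1 (r(d := m (r a)), m)"
| exec_Store: "exec W sub (Store a b) (r, m) 1 (r, m(r a := r b))"
| exec_Call: "exec W None H (cells [r a, r b, r p, r q], cells []) t (r', m') \<Longrightarrow>
    exec W (Some H) (Call d a b p q) (r, m) (t + 1) (r(d := r' 0), m)"
| exec_Seq: "exec W sub c1 s t1 s1 \<Longrightarrow> exec W sub c2 s1 t2 s2 \<Longrightarrow>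
    exec W sub (Seq c1 c2) s (t1 + t2) s2"
| exec_If_True: "r a \<noteq> 0 \<Longrightarrow> exec W sub c1 (r, m) t s \<Longrightarrow>
    exec W sub (If a c1 c2) (r, m) (t + 1) s"
| exec_If_False: "r a = 0 \<Longrightarrow> exec W sub c2 (r, m) t s \<Longrightarrow>
    exec W sub (If a c1 c2) (r, m) (t + 1) s"
| exec_While_True: "r a \<noteq> 0 \<Longrightarrow> exec W sub c (r, m) t1 s1 \<Longrightarrow>
    exec W sub (While a c) s1 t2 s2 \<Longrightarrow> exec W sub (While a c) (r, m) (t1 + t2 + 1) s2"
| exec_While_False: "r a = 0 \<Longrightarrow> exec W sub (While a c) (r, m) 1 (r, m)"

text \<open>Started with the words \<open>args\<close> in the first registers and the words \<open>ds\<close> in the first memory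
  cells (all else zero), \<open>c\<close> halts after exactly \<open>t\<close> steps with \<open>v\<close> in register \<open>0\<close>.\<close>

definition outputs :: "nat \<Rightarrow> com option \<Rightarrow> com \<Rightarrow> nat list \<Rightarrow> nat list \<Rightarrow> nat \<Rightarrow> nat \<Rightarrow> bool" where
  "outputs W sub c args ds t v \<longleftrightarrow>
     (\<exists>r m. exec W sub c (cells args, cells ds) t (r, m) \<and> r 0 = v)"


section \<open>Substring queries\<close>

text \<open>Equal to \<open>log 2 n\<close> for \<open>n \<ge> 2\<close>; the maximum only keeps a bound \<open>C * lg n\<close> meaningful at
  \<open>n = 1\<close>.\<close>

definition lg :: "nat \<Rightarrow> real" where
  "lg n = max 1 (log 2 (real n))"

text \<open>\<open>w[i:j]\<close>, one-based and inclusive.\<close>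

definition substring :: "'a list \<Rightarrow> nat \<Rightarrow> nat \<Rightarrow> 'a list" where
  "substring w i j = take (Suc j - i) (drop (i - 1) w)"

text \<open>\<open>H\<close> computes \<open>h\<close> in at most \<open>T\<close> steps, elements of the range of \<open>f\<close> being represented by
  machine words through \<open>enc\<close>. Only the arguments that can occur for strings of total length at
  most \<open>n\<close> are required; this makes the hypothesis weaker than computability on all arguments,
  some of which do not fit into machine words.\<close>

definition computes_combination ::
  "nat \<Rightarrow> ('b \<Rightarrow> nat) \<Rightarrow> nat \<Rightarrow> ('a list \<Rightarrow> 'b) \<Rightarrow> ('b \<Rightarrow> 'b \<Rightarrow> nat \<Rightarrow> nat \<Rightarrow> 'b) \<Rightarrow>
   com \<Rightarrow> nat \<Rightarrow> bool" where
  "computes_combination W enc n f h H T \<longleftrightarrow>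
     (\<forall>x y. length x + length y \<le> n \<longrightarrow>
        (\<exists>t\<le>T. outputs W None H [enc (f x), enc (f y), length x, length y] [] t
                 (enc (h (f x) (f y) (length x) (length y)))))"

text \<open>The query program \<open>Q\<close>, given the word array \<open>ds\<close> and the subroutine \<open>H\<close>, answers every
  query on \<open>w\<close> within time \<open>B\<close>.\<close>

definition answers_queries ::
  "nat \<Rightarrow> ('b \<Rightarrow> nat) \<Rightarrow> 'a list \<Rightarrow> ('a list \<Rightarrow> 'b) \<Rightarrow> com \<Rightarrow> com \<Rightarrow> nat list \<Rightarrow> real \<Rightarrow> bool" where
  "answers_queries W enc w f H Q ds B \<longleftrightarrow>
     (\<forall>i j. 1 \<le> i \<and> i \<le> j \<and> j \<le> length w \<longrightarrow>
        (\<exists>t. real t \<le> B \<and> outputs W (Some H) Q [i, j] ds t (enc (f (substring w i j)))))"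

end

(* Unfolding a grammar gives a tree over leaves, concatenations and powers, whose number of distinct
subtrees is at most the size of the grammar. Let occ u count the occurrences of a subtree u and call
an edge heavy if neither floor(log |u|) nor floor(log (occ u)) changes along it. Every node has at
most one heavy child and one heavy parent, so the heavy edges form disjoint paths, and any descent
crosses O(log n) light edges. Replacing each path by a binary tree, biased by the numbers of entries
and by the lengths of the subtrees hanging off, makes the costs of the path traversals telescope: the
number of distinct subtrees grows by a constant factor only, and the height becomes O(log n).

Each subtree is then stored as a record of five words: its length, its value under f, and two children
l, r with an exponent c such that its string is l^c r. A query descends to the node where the range
splits into a suffix, a power and a prefix, and each of these is accumulated along a further descent.
A power l^q costs O(log q) combinations by repeated squaring, and since |l| is then at most a q-th of
the current length, these logarithms add up to O(log n) along a descent. *)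
theory Submission
  imports Defs "HOL-Library.Discrete_Functions"
begin

text \<open>The depth of a grammar can be linear in \<open>n\<close>, and it has to be lowered
  without losing the sharing of subtrees. Length classes alone give every node at most one heavy
  child, but a shared node may have many parents of its own class, so that the heavy edges would
  branch; the occurrence classes give at most one heavy parent as well. The two classes move in
  opposite directions along an edge, so they combine into one potential, at most twice the logarithm
  of \<open>n\<close>, that every light edge lowers.

  A power cannot be unrolled into concatenations, since that costs logarithmically many nodes for a
  rule of size two. It stays a single node. As it is more than twice as long as its body, it can
  only be the last node of a heavy path, and the biased trees have to deal with concatenations only.
  The price is paid by the query, which evaluates powers on the fly; no intermediate string there is
  longer than \<open>n\<close>, so the combination function is called only where its running time is
  known.\<close>

datatype 'a slp = Chr 'a | App "'a slp" "'a slp" | Pow "'a slp" nat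

fun yield :: "'a slp \<Rightarrow> 'a list" where
  "yield (Chr a) = [a]"
| "yield (App l r) = yield l @ yield r"
| "yield (Pow b k) = concat (replicate k (yield b))"

fun slp_ok :: "'a slp \<Rightarrow> bool" where
  "slp_ok (Chr a) = True"
| "slp_ok (App l r) = (slp_ok l \<and> slp_ok r)"
| "slp_ok (Pow b k) = (slp_ok b \<and> k > 2)"

fun subs :: "'a slp \<Rightarrow> 'a slp set" where
  "subs (Chr a) = {Chr a}"
| "subs (App l r) = insert (App l r) (subs l \<union> subs r)"
| "subs (Pow b k) = insert (Pow b k) (subs b)"

fun kids :: "'a slp \<Rightarrow> 'a slp set" where
  "kids (Chr a) = {}"
| "kids (App l r) = {l, r}"
| "kids (Pow b k) = {b}"

fun height :: "'a slp \<Rightarrow> nat" where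
  "height (Chr a) = 0"
| "height (App l r) = Suc (max (height l) (height r))"
| "height (Pow b k) = Suc (height b)"

abbreviation len :: "'a slp \<Rightarrow> nat" where
  "len t \<equiv> length (yield t)"

section \<open>Elementary facts on subtrees, lengths and heights\<close>

lemma length_concat_replicate [simp]: "length (concat (replicate k xs)) = k * length xs"
  by (induction k) auto

lemma finite_subs [simp]: "finite (subs t)"
  by (induction t) auto

lemma subs_self [simp]: "t \<in> subs t"
  by (cases t) auto

lemma subs_trans: "u \<in> subs t \<Longrightarrow> subs u \<subseteq> subs t"
  by (induction t) auto

lemma subs_kids: "subs t = insert t (\<Union>(subs ` kids t))"
  by (cases t) auto

lemma kids_in_subs: "u \<in> subs t \<Longrightarrow> kids u \<subseteq> subs t"
  using subs_trans[of u t] subs_kids[of u] by fastforce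

lemma slp_ok_subs: "slp_ok t \<Longrightarrow> u \<in> subs t \<Longrightarrow> slp_ok u"
  by (induction t) auto

lemma len_pos: "slp_ok t \<Longrightarrow> 0 < len t"
  by (induction t) auto

lemma size_subs: "u \<in> subs t \<Longrightarrow> size u \<le> size t"
  by (induction t) auto

lemma size_kids: "u \<in> kids t \<Longrightarrow> size u < size t"
  by (cases t) auto

lemma height_subs: "u \<in> subs t \<Longrightarrow> height u \<le> height t"
  by (induction t) auto

lemma len_kids: "slp_ok t \<Longrightarrow> u \<in> kids t \<Longrightarrow> len u \<le> len t"
  by (cases t) auto

lemma len_subs:
  assumes "slp_ok t" "u \<in> subs t"
  shows "len u \<le> len t"
  using assms
proof (induction t)
  case (Pow b k)
  show ?case
  proof (cases "u = Pow b k")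
    case False
    then have "len u \<le> len b" using Pow by auto
    also have "len b \<le> k * len b" using Pow.prems by simp
    finally show ?thesis by simp
  qed simp
qed (auto intro: trans_le_add1 trans_le_add2)

text \<open>A binary tree has fewer inner nodes than leaves, and a power, though unary, at least
  doubles the length. The bound makes all record addresses fit into words of logarithmic
  size.\<close>

lemma card_subs_le: "slp_ok t \<Longrightarrow> card (subs t) \<le> 2 * len t - 1"
proof (induction t)
  case (App l r)
  have "card (subs (App l r)) \<le> Suc (card (subs l \<union> subs r))"
    by (simp add: card_insert_if)
  moreover have "card (subs l \<union> subs r) \<le> card (subs l) + card (subs r)"
    by (rule card_Un_le)
  moreover have "0 < len l" "0 < len r" using App.prems len_pos by auto
  ultimately show ?case using App by (simp del: length_greater_0_conv)
next
  case (Pow b k)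
  have "card (subs (Pow b k)) \<le> Suc (card (subs b))"
    by (simp add: card_insert_if)
  moreover have "2 * len b \<le> len (Pow b k)" using Pow.prems by simp
  moreover have "0 < len b" using Pow.prems len_pos by auto
  moreover have "card (subs b) \<le> 2 * len b - 1" using Pow by auto
  ultimately show ?case by linarith
qed auto


section \<open>From grammars to shared trees\<close>

fun cat :: "'a slp list \<Rightarrow> 'a slp" where
  "cat [] = undefined"
| "cat [x] = x"
| "cat (x # y # xs) = App x (cat (y # xs))"

fun spine :: "'a slp list \<Rightarrow> 'a slp set" where
  "spine [] = {}"
| "spine [x] = {}"
| "spine (x # y # xs) = insert (cat (x # y # xs)) (spine (y # xs))"

lemma yield_cat: "xs \<noteq> [] \<Longrightarrow> yield (cat xs) = concat (map yield xs)"
  by (induction xs rule: cat.induct) auto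

lemma slp_ok_cat: "xs \<noteq> [] \<Longrightarrow> (\<And>x. x \<in> set xs \<Longrightarrow> slp_ok x) \<Longrightarrow> slp_ok (cat xs)"
  by (induction xs rule: cat.induct) auto

lemma subs_cat: "xs \<noteq> [] \<Longrightarrow> subs (cat xs) \<subseteq> spine xs \<union> \<Union>(subs ` set xs)"
  by (induction xs rule: cat.induct) auto

lemma finite_spine [simp]: "finite (spine xs)"
  by (induction xs rule: spine.induct) auto

lemma card_spine: "card (spine xs) \<le> length xs - 1"
  by (induction xs rule: spine.induct) (auto simp: card_insert_if)

fun rhs_tree :: "('v \<Rightarrow> 'a slp) \<Rightarrow> ('v, 'a) rhs \<Rightarrow> 'a slp" where
  "rhs_tree T (Term a) = Chr a"
| "rhs_tree T (Cat Bs) = cat (map T Bs)"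
| "rhs_tree T (Rep B t) = Pow (T B) t"

text \<open>The nodes that one rule adds to the trees of its variables. A concatenation of
  \<open>k\<close> variables adds only the \<open>k - 1\<close> nodes of its \<open>spine\<close>,
  so no rule adds more nodes than its size.\<close>

fun rhs_nodes :: "('v \<Rightarrow> 'a slp) \<Rightarrow> ('v, 'a) rhs \<Rightarrow> 'a slp set" where
  "rhs_nodes T (Term a) = {Chr a}"
| "rhs_nodes T (Cat Bs) = spine (map T Bs)"
| "rhs_nodes T (Rep B t) = {Pow (T B) t}"

lemma rhs_tree_cong:
  "(\<And>B. B \<in> rhs_vars \<rho> \<Longrightarrow> T B = T' B) \<Longrightarrow> rhs_tree T \<rho> = rhs_tree T' \<rho>"
  by (cases \<rho>) (auto cong: map_cong)

lemma subs_rhs_tree: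
  "rhs_ok \<rho> \<Longrightarrow> subs (rhs_tree T \<rho>) \<subseteq> rhs_nodes T \<rho> \<union> \<Union>(subs ` T ` rhs_vars \<rho>)"
proof (cases \<rho>)
  case (Cat Bs)
  assume "rhs_ok \<rho>"
  then have "map T Bs \<noteq> []" using Cat by auto
  from subs_cat[OF this] show ?thesis using Cat by simp
qed auto

lemma card_rhs_nodes: "rhs_ok \<rho> \<Longrightarrow> finite (rhs_nodes T \<rho>) \<and> card (rhs_nodes T \<rho>) \<le> rhs_size \<rho>"
proof (cases \<rho>)
  case (Cat Bs)
  then show ?thesis using card_spine[of "map T Bs"] by simp
qed auto

lemma slp_ok_rhs_tree:
  "rhs_ok \<rho> \<Longrightarrow> (\<And>B. B \<in> rhs_vars \<rho> \<Longrightarrow> slp_ok (T B)) \<Longrightarrow> slp_ok (rhs_tree T \<rho>)"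
  by (cases \<rho>) (auto intro!: slp_ok_cat)

lemma derives_rhs_tree:
  assumes "rule G A = \<rho>" "rhs_ok \<rho>" "\<And>B. B \<in> rhs_vars \<rho> \<Longrightarrow> derives G B (yield (T B))"
  shows "derives G A (yield (rhs_tree T \<rho>))"
proof (cases \<rho>)
  case (Cat Bs)
  then have "Bs \<noteq> []" using assms(2) by auto
  then have *: "yield (rhs_tree T \<rho>) = concat (map (yield \<circ> T) Bs)"
    using Cat by (simp add: yield_cat)
  have "derives G A (concat (map (yield \<circ> T) Bs))"
    by (rule derives_Cat[of _ _ Bs])
      (use assms Cat in \<open>auto simp: list_all2_conv_all_nth\<close>)
  then show ?thesis using * by simp
qed (use assms in \<open>auto intro: derives.intros\<close>)

text \<open>Recursion on fuel, since the well-foundedness of a grammar is only a hypothesis.\<close>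

fun unfold_tree :: "('v, 'a) grammar \<Rightarrow> nat \<Rightarrow> 'v \<Rightarrow> 'a slp" where
  "unfold_tree G 0 = (\<lambda>_. undefined)"
| "unfold_tree G (Suc d) = (\<lambda>A. rhs_tree (unfold_tree G d) (rule G A))"

text \<open>Every subtree of the unfolded start variable is a node added by some rule. The union
  over rules ignores how often a variable is used, which is why the exponential blow-up of the
  unfolding does no harm.\<close>

lemma grammar_tree_ex:
  fixes G :: "('v, 'a) grammar"
  assumes "generates G w"
  obtains t where "yield t = w" "slp_ok t" "card (subs t) \<le> rlslp_size G"
proof -
  have fin: "finite (vars G)" and st: "start G \<in> vars G"
    and rok: "\<And>A. A \<in> vars G \<Longrightarrow> rhs_ok (rule G A)"
    and rv: "\<And>A. A \<in> vars G \<Longrightarrow> rhs_vars (rule G A) \<subseteq> vars G"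
    using assms unfolding generates_def rlslp_def by auto
  obtain rank :: "'v \<Rightarrow> nat" where "\<forall>A\<in>vars G. \<forall>B\<in>rhs_vars (rule G A). rank B < rank A"
    using assms unfolding generates_def rlslp_def by blast
  then have rank: "\<And>A B. A \<in> vars G \<Longrightarrow> B \<in> rhs_vars (rule G A) \<Longrightarrow> rank B < rank A" by blast
  \<comment> \<open>Any fuel above the rank gives the same tree, so the trees \<open>T A\<close>
    satisfy the recursion equations of the grammar.\<close>
  have indep: "A \<in> vars G \<Longrightarrow> rank A < d \<Longrightarrow> rank A < d' \<Longrightarrow> unfold_tree G d A = unfold_tree G d' A"
    for A d d'
  proof (induction d arbitrary: d' A)
    case (Suc d)
    from Suc.prems obtain e where e: "d' = Suc e" by (cases d') auto
    have "unfold_tree G d B = unfold_tree G e B" if "B \<in> rhs_vars (rule G A)" for B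
      using that Suc.prems rank[of A B] rv[of A] e by (intro Suc.IH) auto
    then show ?case unfolding e by (auto intro: rhs_tree_cong)
  qed simp
  define T where "T A = unfold_tree G (Suc (rank A)) A" for A
  have T: "T A = rhs_tree T (rule G A)" if A: "A \<in> vars G" for A
  proof -
    have "unfold_tree G (rank A) B = T B" if B: "B \<in> rhs_vars (rule G A)" for B
      unfolding T_def by (rule indep) (use A B rank rv in auto)
    then show ?thesis unfolding T_def[of A] unfold_tree.simps by (rule rhs_tree_cong)
  qed
  have main: "A \<in> vars G \<Longrightarrow> derives G A (yield (T A)) \<and> slp_ok (T A) \<and>
      subs (T A) \<subseteq> (\<Union>B\<in>vars G. rhs_nodes T (rule G B))" for A
  proof (induction "rank A" arbitrary: A rule: less_induct)
    case less
    have IH: "derives G B (yield (T B))" "slp_ok (T B)"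
      "subs (T B) \<subseteq> (\<Union>B\<in>vars G. rhs_nodes T (rule G B))" if "B \<in> rhs_vars (rule G A)" for B
      using less.hyps[OF rank[OF less.prems that]] rv[OF less.prems] that by auto
    have "subs (rhs_tree T (rule G A)) \<subseteq> (\<Union>B\<in>vars G. rhs_nodes T (rule G B))"
      using subs_rhs_tree[OF rok[OF less.prems], of T] IH(3) less.prems by fastforce
    moreover have "derives G A (yield (rhs_tree T (rule G A)))"
      by (rule derives_rhs_tree) (use IH rok less.prems in auto)
    moreover have "slp_ok (rhs_tree T (rule G A))"
      by (rule slp_ok_rhs_tree) (use IH rok less.prems in auto)
    ultimately show ?case using T[OF less.prems] by simp
  qed
  have "card (subs (T (start G))) \<le> card (\<Union>B\<in>vars G. rhs_nodes T (rule G B))"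
    by (rule card_mono) (use main[OF st] fin card_rhs_nodes rok in auto)
  also have "\<dots> \<le> (\<Sum>B\<in>vars G. card (rhs_nodes T (rule G B)))"
    by (rule card_UN_le[OF fin])
  also have "\<dots> \<le> rlslp_size G"
    unfolding rlslp_size_def by (rule sum_mono) (use card_rhs_nodes rok in auto)
  finally have "card (subs (T (start G))) \<le> rlslp_size G" .
  moreover have "yield (T (start G)) = w"
    using main[OF st] assms derives_unique[of G "start G"] by (auto simp: generates_def)
  ultimately show ?thesis using main[OF st] that[of "T (start G)"] by simp
qed

lemma g_rl_tree_ex:
  fixes w :: "'a list"
  assumes "w \<noteq> []"
  obtains t where "yield t = w" "slp_ok t" "card (subs t) \<le> g_rl w"
proof -
  obtain G0 :: "(nat, 'a) grammar" where "generates G0 w" using generates_ex[OF assms] by blast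
  then have "\<exists>s. \<exists>G :: (nat, 'a) grammar. generates G w \<and> rlslp_size G = s" by blast
  then have "\<exists>G :: (nat, 'a) grammar. generates G w \<and> rlslp_size G = g_rl w"
    unfolding g_rl_def by (rule LeastI_ex)
  then obtain G :: "(nat, 'a) grammar" where G: "generates G w" "rlslp_size G = g_rl w" by blast
  from grammar_tree_ex[OF G(1)] obtain t where "yield t = w" "slp_ok t" "card (subs t) \<le> rlslp_size G" .
  then show ?thesis using that G(2) by simp
qed


section \<open>Weight-biased trees over a path\<close>

text \<open>An item \<open>(d, c, w)\<close> is a binary context with the tree \<open>c\<close> to the left of the hole if \<open>d\<close> holds
  and to its right otherwise; \<open>w\<close> is its weight.\<close>

type_synonym 'a item = "bool \<times> 'a slp \<times> nat"

abbreviation side :: "'a item \<Rightarrow> 'a slp" where "side x \<equiv> fst (snd x)"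
abbreviation weight :: "'a item \<Rightarrow> nat" where "weight x \<equiv> snd (snd x)"

fun nest :: "'a item list \<Rightarrow> 'a slp \<Rightarrow> 'a slp" where
  "nest [] t = t"
| "nest ((d, c, w) # xs) t = (if d then App c (nest xs t) else App (nest xs t) c)"

fun lefts :: "'a item list \<Rightarrow> 'a list" where
  "lefts [] = []"
| "lefts ((d, c, w) # xs) = (if d then yield c else []) @ lefts xs"

fun rights :: "'a item list \<Rightarrow> 'a list" where
  "rights [] = []"
| "rights ((d, c, w) # xs) = rights xs @ (if d then [] else yield c)"

lemma yield_nest: "yield (nest xs t) = lefts xs @ yield t @ rights xs"
  by (induction xs rule: lefts.induct) auto

lemma lefts_append [simp]: "lefts (xs @ ys) = lefts xs @ lefts ys"
  by (induction xs rule: lefts.induct) auto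

lemma rights_append [simp]: "rights (xs @ ys) = rights ys @ rights xs"
  by (induction xs rule: rights.induct) auto

text \<open>The set \<open>Y\<close> is a common pool of nodes. Trees built for different positions
  draw on one pool, so that bounding the pool counts every shared node once.\<close>

definition good :: "'a slp set \<Rightarrow> nat \<Rightarrow> 'a slp \<Rightarrow> bool" where
  "good Y e t \<longleftrightarrow> slp_ok t \<and> subs t \<subseteq> Y \<and> height t \<le> e"

lemma good_mono: "good Y e t \<Longrightarrow> Y \<subseteq> Y' \<Longrightarrow> e \<le> e' \<Longrightarrow> good Y' e' t"
  unfolding good_def by auto

lemma good_App: "good Y e s \<Longrightarrow> good Y e t \<Longrightarrow> good (insert (App s t) Y) (Suc e) (App s t)"
  unfolding good_def by auto

text \<open>\<open>None\<close> stands for the empty string, which has no tree: a path may have no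
  side trees on one of its two sides.\<close>

fun ogood :: "'a slp set \<Rightarrow> nat \<Rightarrow> 'a slp option \<Rightarrow> bool" where
  "ogood Y e None = True"
| "ogood Y e (Some t) = good Y e t"

fun oyield :: "'a slp option \<Rightarrow> 'a list" where
  "oyield None = []"
| "oyield (Some t) = yield t"

fun ocat :: "'a slp option \<Rightarrow> 'a slp option \<Rightarrow> 'a slp option" where
  "ocat None y = y"
| "ocat (Some s) None = Some s"
| "ocat (Some s) (Some t) = Some (App s t)"

lemma ogood_mono: "ogood Y e x \<Longrightarrow> Y \<subseteq> Y' \<Longrightarrow> e \<le> e' \<Longrightarrow> ogood Y' e' x"
  by (cases x) (auto intro: good_mono)

lemma oyield_ocat [simp]: "oyield (ocat x y) = oyield x @ oyield y"
  by (cases "(x, y)" rule: ocat.cases) auto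

text \<open>A node is charged only if both operands are present. This precision is what keeps the
  cost of a path item at three nodes.\<close>

lemma ogood_ocat:
  assumes "ogood Y e x" "ogood Y e y"
  shows "\<exists>Z. finite Z \<and> card Z \<le> (if x = None \<or> y = None then 0 else 1) \<and>
    ogood (Z \<union> Y) (Suc e) (ocat x y)"
proof (cases "x = None \<or> y = None")
  case True
  then have "ocat x y = x \<or> ocat x y = y" by (cases "(x, y)" rule: ocat.cases) auto
  then show ?thesis using True assms ogood_mono[OF _ subset_refl, of Y e _ "Suc e"]
    by (intro exI[of _ "{}"]) auto
next
  case False
  then obtain s t where st: "x = Some s" "y = Some t" by auto
  then show ?thesis using good_App[of Y e s t] assms
    by (intro exI[of _ "{App s t}"]) auto
qed

lemma good_oapp:
  assumes "ogood Y e x" "good Y e t" "ogood Y (Suc e) y"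
  shows "\<exists>Z s. finite Z \<and> card Z \<le> (if x = None then 0 else 1) + (if y = None then 0 else 1) \<and>
    good (Z \<union> Y) (e + 2) s \<and> yield s = oyield x @ yield t @ oyield y"
proof -
  define s where "s = (case x of None \<Rightarrow> t | Some x \<Rightarrow> App x t)"
  define Z where "Z = (if x = None then {} else {s})"
  have s: "good (Z \<union> Y) (Suc e) s" "yield s = oyield x @ yield t"
    using assms(1,2) good_App[of Y e "the x" t] good_mono[OF assms(2) subset_refl, of "Suc e"]
    unfolding s_def Z_def by (auto split: option.splits)
  define s' where "s' = (case y of None \<Rightarrow> s | Some y \<Rightarrow> App s y)"
  define Z' where "Z' = (if y = None then {} else {s'})"
  have "good (Z' \<union> Z \<union> Y) (e + 2) s'" "yield s' = yield s @ oyield y"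
    using good_App[of "Z \<union> Y" "Suc e" s "the y"] s(1) good_mono[OF s(1) subset_refl, of "e + 2"]
      ogood_mono[OF assms(3), of "Z \<union> Y" "Suc e"]
    unfolding s'_def Z'_def by (auto split: option.splits)
  moreover have "card (Z' \<union> Z) \<le> (if x = None then 0 else 1) + (if y = None then 0 else 1)"
    by (rule order_trans[OF card_Un_le]) (auto simp: Z_def Z'_def)
  moreover have "finite (Z' \<union> Z)" unfolding Z_def Z'_def by auto
  ultimately show ?thesis using s(2) by (metis append.assoc)
qed

lemma weighted_prefix:
  fixes h :: nat
  assumes "xs \<noteq> []" "0 < h"
  shows "\<exists>ys x zs. xs = ys @ x # zs \<and> sum_list (map f ys) < h \<and>
    (zs = [] \<or> h \<le> sum_list (map f ys) + f x)"
  using assms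
proof (induction xs arbitrary: h)
  case (Cons x xs)
  show ?case
  proof (cases "h \<le> f x \<or> xs = []")
    case True
    then show ?thesis using Cons.prems by (intro exI[of _ "[]"] exI[of _ x] exI[of _ xs]) auto
  next
    case False
    then obtain ys y zs where "xs = ys @ y # zs" "sum_list (map f ys) < h - f x"
      "zs = [] \<or> h - f x \<le> sum_list (map f ys) + f y"
      using Cons.IH[of "h - f x"] by auto
    then show ?thesis
      by (intro exI[of _ "x # ys"] exI[of _ y] exI[of _ zs]) auto
  qed
qed simp

text \<open>The median item may carry almost all of the weight. It is placed near the root at once,
  and only the two remainders, each below half, are treated recursively.\<close>

lemma weighted_median:
  fixes h :: nat
  assumes "sum_list (map f xs) < 2 * h" "xs \<noteq> []"
  obtains ys x zs where "xs = ys @ x # zs" "sum_list (map f ys) < h" "sum_list (map f zs) < h"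
proof -
  obtain ys x zs where *: "xs = ys @ x # zs" "sum_list (map f ys) < h"
    "zs = [] \<or> h \<le> sum_list (map f ys) + f x"
    using weighted_prefix[OF assms(2), of h f] assms(1) by auto
  then have "sum_list (map f zs) < h" using assms(1) by auto
  then show ?thesis using that * by blast
qed

lemma floor_log_less: "0 < w \<Longrightarrow> w < 2 ^ M \<Longrightarrow> floor_log w < M"
  by (meson floor_log_exp2_le le_less_trans nat_power_less_imp_less zero_less_numeral)

text \<open>The depth at which an item hangs in the biased tree is governed by \<open>M\<close>, the
  logarithm of the total weight, minus that of its own weight, with three levels for every halving.
  \<open>D\<close> bounds this depth together with the height of the side tree.\<close>

definition fits :: "'a slp set \<Rightarrow> nat \<Rightarrow> nat \<Rightarrow> 'a item \<Rightarrow> bool" where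
  "fits B M D x \<longleftrightarrow> 0 < weight x \<and> slp_ok (side x) \<and> subs (side x) \<subseteq> B \<and>
     height (side x) + 3 * (M - floor_log (weight x)) \<le> D"

text \<open>Recursion on the weighted median \<open>m\<close>. What follows the left half of the path is the tree built
  for \<open>m\<close>, so that all suffixes of the path share the trees of the right ends and only a constant
  number of new nodes per item is needed.\<close>

lemma biased_trees_ex:
  assumes "sum_list (map weight xs) < 2 ^ M" "\<forall>x\<in>set xs. fits B M D x"
  shows "\<exists>L R N. finite N \<and> card N \<le> 3 * length xs \<and> ogood (N \<union> B) D L \<and> ogood (N \<union> B) D R \<and>
    oyield L = lefts xs \<and> oyield R = rights xs \<and>
    (\<forall>t e X. D \<le> e \<longrightarrow> good X e t \<longrightarrow> (\<exists>S N'. finite N' \<and> card N' \<le> 3 * length xs \<and>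
      (\<forall>i<length xs. good (N \<union> N' \<union> B \<union> X) (e + 3 * (M - floor_log (weight (xs ! i)))) (S i) \<and>
         yield (S i) = yield (nest (drop i xs) t))))"
  using assms
proof (induction M arbitrary: xs D)
  case 0
  then have "xs = []" by (cases xs) (auto simp: fits_def)
  then show ?case by (intro exI[of _ None] exI[of _ "{}"]) auto
next
  case (Suc M)
  show ?case
  proof (cases "xs = []")
    case True
    then show ?thesis by (intro exI[of _ None] exI[of _ "{}"]) auto
  next
    case False
    obtain ys m zs where xs: "xs = ys @ m # zs" and ys: "sum_list (map weight ys) < 2 ^ M"
      and zs: "sum_list (map weight zs) < 2 ^ M"
      by (rule weighted_median[of weight xs "2 ^ M"]) (use Suc.prems False in auto)
    obtain d c w where m: "m = (d, c, w)" by (cases m) auto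
    have small: "weight x < 2 ^ M" if "x \<in> set ys \<union> set zs" for x
    proof -
      have "weight x \<le> sum_list (map weight xs)" if "x \<in> set xs" for xs
        by (rule member_le_sum_list) (use that in auto)
      then show ?thesis using that ys zs le_less_trans by blast
    qed
    \<comment> \<open>Items outside the median weigh less than half, so the subtraction is not
      truncated and passing to a half really gains one unit, that is, three levels of
      height.\<close>
    have shift: "Suc M - floor_log (weight x) = Suc (M - floor_log (weight x))"
      if "x \<in> set ys \<union> set zs" for x
    proof -
      have "0 < weight x" using Suc.prems(2) that by (auto simp: xs fits_def)
      then show ?thesis using floor_log_less[OF _ small[OF that]] by auto
    qed
    have wm: "w < 2 ^ Suc M" "0 < w"
      using Suc.prems unfolding xs m fits_def by auto
    have shm: "Suc M - floor_log w = Suc (M - floor_log w)"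
      using floor_log_less[OF wm(2,1)] by auto
    have D: "3 \<le> D" using Suc.prems(2) shm unfolding xs m fits_def by auto
    have "fits B M (D - 3) x" if x: "x \<in> set ys \<union> set zs" for x
    proof -
      have "fits B (Suc M) D x" using Suc.prems(2) x by (auto simp: xs)
      then show ?thesis unfolding fits_def shift[OF x] by auto
    qed
    then have fits: "\<forall>x\<in>set ys. fits B M (D - 3) x" "\<forall>x\<in>set zs. fits B M (D - 3) x"
      by auto
    have c: "good B (D - 3) c"
      using Suc.prems(2) shm unfolding xs m fits_def good_def by auto
    obtain Ll Rl Nl where l: "finite Nl" "card Nl \<le> 3 * length ys" "ogood (Nl \<union> B) (D - 3) Ll"
      "ogood (Nl \<union> B) (D - 3) Rl" "oyield Ll = lefts ys" "oyield Rl = rights ys"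
      and lS: "\<And>t e X. D - 3 \<le> e \<Longrightarrow> good X e t \<Longrightarrow> \<exists>S N'. finite N' \<and> card N' \<le> 3 * length ys \<and>
      (\<forall>i<length ys. good (Nl \<union> N' \<union> B \<union> X) (e + 3 * (M - floor_log (weight (ys ! i)))) (S i) \<and>
         yield (S i) = yield (nest (drop i ys) t))"
      using Suc.IH[OF ys fits(1)] by blast
    obtain Lr Rr Nr where r: "finite Nr" "card Nr \<le> 3 * length zs" "ogood (Nr \<union> B) (D - 3) Lr"
      "ogood (Nr \<union> B) (D - 3) Rr" "oyield Lr = lefts zs" "oyield Rr = rights zs"
      and rS: "\<And>t e X. D - 3 \<le> e \<Longrightarrow> good X e t \<Longrightarrow> \<exists>S N'. finite N' \<and> card N' \<le> 3 * length zs \<and>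
      (\<forall>i<length zs. good (Nr \<union> N' \<union> B \<union> X) (e + 3 * (M - floor_log (weight (zs ! i)))) (S i) \<and>
         yield (S i) = yield (nest (drop i zs) t))"
      using Suc.IH[OF zs fits(2)] by blast
    define P where "P = Nl \<union> Nr \<union> B"
    define cl where "cl = (if d then Some c else None)"
    define cr where "cr = (if d then None else Some c)"
    have P: "ogood P (D - 3) Ll" "ogood P (D - 3) Rl" "ogood P (D - 3) Lr" "ogood P (D - 3) Rr"
      "ogood P (D - 3) cl" "ogood P (D - 3) cr"
      using l r c unfolding P_def cl_def cr_def by (auto intro: ogood_mono good_mono)
    obtain Z1 where Z1: "finite Z1" "card Z1 \<le> (if cl = None \<or> Lr = None then 0 else 1)"
      "ogood (Z1 \<union> P) (Suc (D - 3)) (ocat cl Lr)"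
      using ogood_ocat[OF P(5,3)] by blast
    obtain Z2 where Z2: "finite Z2" "card Z2 \<le> (if Ll = None \<or> ocat cl Lr = None then 0 else 1)"
      "ogood (Z2 \<union> (Z1 \<union> P)) (Suc (Suc (D - 3))) (ocat Ll (ocat cl Lr))"
      using ogood_ocat[OF ogood_mono[OF P(1)] Z1(3)] by auto
    obtain Z3 where Z3: "finite Z3" "card Z3 \<le> (if Rr = None \<or> cr = None then 0 else 1)"
      "ogood (Z3 \<union> P) (Suc (D - 3)) (ocat Rr cr)"
      using ogood_ocat[OF P(4,6)] by blast
    obtain Z4 where Z4: "finite Z4" "card Z4 \<le> (if ocat Rr cr = None \<or> Rl = None then 0 else 1)"
      "ogood (Z4 \<union> (Z3 \<union> P)) (Suc (Suc (D - 3))) (ocat (ocat Rr cr) Rl)"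
      using ogood_ocat[OF Z3(3) ogood_mono[OF P(2)]] by auto
    \<comment> \<open>Exactly one of \<open>cl\<close> and \<open>cr\<close> is \<open>None\<close>,
      so only one of \<open>Z1\<close> and \<open>Z3\<close> can be nonempty; with \<open>Z2\<close>
      and \<open>Z4\<close> this makes three nodes, charged to \<open>m\<close>.\<close>
    have "card Z1 \<le> (if d then 1 else 0)" "card Z3 \<le> (if d then 0 else 1)" "card Z2 \<le> 1" "card Z4 \<le> 1"
      using Z1(2) Z2(2) Z3(2) Z4(2) unfolding cl_def cr_def by (auto split: if_splits)
    note cards = this
    define Z where "Z = (Z1 \<union> Z2) \<union> (Z3 \<union> Z4)"
    have "card Z \<le> 3"
      unfolding Z_def using cards card_Un_le[of "Z1 \<union> Z2" "Z3 \<union> Z4"]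
        card_Un_le[of Z1 Z2] card_Un_le[of Z3 Z4] by (auto split: if_splits)
    define N where "N = (Nl \<union> Nr) \<union> Z"
    have "card N \<le> 3 * length xs"
      unfolding N_def using \<open>card Z \<le> 3\<close> card_Un_le[of "Nl \<union> Nr" Z] card_Un_le[of Nl Nr] l(2) r(2)
      by (simp add: xs)
    moreover have "finite N" unfolding N_def Z_def using l r Z1 Z2 Z3 Z4 by auto
    moreover have "ogood (N \<union> B) D (ocat Ll (ocat cl Lr))"
      by (rule ogood_mono[OF Z2(3)]) (use D in \<open>auto simp: N_def Z_def P_def\<close>)
    moreover have "ogood (N \<union> B) D (ocat (ocat Rr cr) Rl)"
      by (rule ogood_mono[OF Z4(3)]) (use D in \<open>auto simp: N_def Z_def P_def\<close>)
    moreover have "oyield (ocat Ll (ocat cl Lr)) = lefts xs" "oyield (ocat (ocat Rr cr) Rl) = rights xs"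
      using l r unfolding xs m cl_def cr_def by auto
    moreover have "\<exists>S N'. finite N' \<and> card N' \<le> 3 * length xs \<and>
      (\<forall>i<length xs. good (N \<union> N' \<union> B \<union> X) (e + 3 * (Suc M - floor_log (weight (xs ! i)))) (S i) \<and>
         yield (S i) = yield (nest (drop i xs) t))" if e: "D \<le> e" and t: "good X e t" for t e X
    proof -
      have "D - 3 \<le> e" using e by simp
      have PX: "ogood (P \<union> X) e Lr" "good (P \<union> X) e t" "ogood (P \<union> X) (Suc e) Rr" "good (P \<union> X) (e + 2) c"
        by (rule ogood_mono[OF P(3)] good_mono[OF t] ogood_mono[OF P(4)] good_mono[OF c];
          use e in \<open>auto simp: P_def\<close>)+
      obtain Y s where Y: "finite Y" "card Y \<le> 2" "good (Y \<union> (P \<union> X)) (e + 2) s"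
        and s: "yield s = lefts zs @ yield t @ rights zs"
      proof -
        obtain Y s where "finite Y" "card Y \<le> (if Lr = None then 0 else 1) + (if Rr = None then 0 else 1)"
          "good (Y \<union> (P \<union> X)) (e + 2) s" "yield s = oyield Lr @ yield t @ oyield Rr"
          using good_oapp[OF PX(1-3)] by blast
        then show ?thesis using that[of Y s] r(5,6) by (simp split: if_splits)
      qed
      \<comment> \<open>The tree of the suffix that starts at the median. It serves as the inner end
        for the whole left half: its three additional levels are offset there by the drop of
        \<open>M\<close>.\<close>
      define u where "u = (if d then App c s else App s c)"
      have u: "good (insert u Y \<union> P \<union> X) (e + 3) u"
        using good_App[OF Y(3) good_mono[OF PX(4), of "Y \<union> (P \<union> X)" "e + 2"]]
          good_App[OF good_mono[OF PX(4), of "Y \<union> (P \<union> X)" "e + 2"] Y(3)]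
        by (simp add: u_def Un_assoc numeral_3_eq_3)
      have yu: "yield u = yield (nest (m # zs) t)"
        using s by (simp add: u_def m yield_nest)
      obtain Sl N1 where N1: "finite N1" "card N1 \<le> 3 * length ys"
        "\<And>i. i < length ys \<Longrightarrow> good (Nl \<union> N1 \<union> B \<union> (insert u Y \<union> P \<union> X)) (e + 3 + 3 * (M - floor_log (weight (ys ! i)))) (Sl i)"
        "\<And>i. i < length ys \<Longrightarrow> yield (Sl i) = yield (nest (drop i ys) u)"
        using lS[OF trans_le_add1[OF \<open>D - 3 \<le> e\<close>] u] by blast
      obtain Sr N2 where N2: "finite N2" "card N2 \<le> 3 * length zs"
        "\<And>i. i < length zs \<Longrightarrow> good (Nr \<union> N2 \<union> B \<union> X) (e + 3 * (M - floor_log (weight (zs ! i)))) (Sr i)"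
        "\<And>i. i < length zs \<Longrightarrow> yield (Sr i) = yield (nest (drop i zs) t)"
        using rS[OF \<open>D - 3 \<le> e\<close> t] by blast
      define S where "S i = (if i < length ys then Sl i else if i = length ys then u
        else Sr (i - Suc (length ys)))" for i
      define N' where "N' = (N1 \<union> N2) \<union> insert u Y"
      have "card (insert u Y) \<le> 3" using Y(1,2) by (simp add: card_insert_if)
      then have "card N' \<le> 3 * length xs"
        unfolding N'_def using card_Un_le[of "N1 \<union> N2" "insert u Y"] card_Un_le[of N1 N2] N1(2) N2(2)
        by (simp add: xs)
      moreover have "finite N'" unfolding N'_def using N1 N2 Y by simp
      moreover have "good (N \<union> N' \<union> B \<union> X) (e + 3 * (Suc M - floor_log (weight (xs ! i)))) (S i) \<and>
         yield (S i) = yield (nest (drop i xs) t)" if i: "i < length xs" for i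
      proof -
        consider "i < length ys" | "i = length ys" | j where "j < length zs" "i = Suc (length ys + j)"
          using i xs less_iff_Suc_add[of "length ys" i] by (auto elim!: linorder_neqE_nat[of i "length ys"])
        then show ?thesis
        proof cases
          case 1
          then have "xs ! i = ys ! i" "ys ! i \<in> set ys" by (auto simp: xs nth_append)
          then have h: "e + 3 * (Suc M - floor_log (weight (xs ! i))) = e + 3 + 3 * (M - floor_log (weight (ys ! i)))"
            using shift[of "ys ! i"] by simp
          have "good (N \<union> N' \<union> B \<union> X) (e + 3 + 3 * (M - floor_log (weight (ys ! i)))) (Sl i)"
            by (rule good_mono[OF N1(3)[OF 1]]) (auto simp: N_def N'_def P_def)
          then show ?thesis
            unfolding h using 1 N1(4)[OF 1] yu by (simp add: S_def xs yield_nest)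
        next
          case 2
          then have "xs ! i = m" by (simp add: xs)
          have "good (N \<union> N' \<union> B \<union> X) (e + 3 * (Suc M - floor_log w)) u"
            unfolding shm by (rule good_mono[OF u]) (auto simp: N_def N'_def P_def)
          then show ?thesis
            using 2 yu \<open>xs ! i = m\<close> m by (simp add: S_def xs)
        next
          case 3
          then have *: "xs ! i = zs ! j" by (simp add: xs nth_append)
          have "good (N \<union> N' \<union> B \<union> X) (e + 3 * (Suc M - floor_log (weight (xs ! i)))) (Sr j)"
            unfolding * by (rule good_mono[OF N2(3)[OF 3(1)]]) (auto simp: N_def N'_def P_def)
          then show ?thesis
            using 3 N2(4)[OF 3(1)] by (simp add: S_def xs)
        qed
      qed
      ultimately show ?thesis by blast
    qed
    ultimately show ?thesis by blast
  qed
qed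


section \<open>Balancing by symmetric centroid decomposition\<close>

text \<open>\<open>occ u t\<close> counts the occurrences of \<open>u\<close> in \<open>t\<close>, where the body of a power counts only once.\<close>

fun occ :: "'a slp \<Rightarrow> 'a slp \<Rightarrow> nat" where
  "occ u (Chr a) = (if Chr a = u then 1 else 0)"
| "occ u (App l r) = (if App l r = u then 1 else 0) + (occ u l + occ u r)"
| "occ u (Pow b k) = (if Pow b k = u then 1 else 0) + occ u b"

lemma occ_eq_0: "u \<notin> subs t \<Longrightarrow> occ u t = 0"
  by (induction t) auto

lemma occ_pos: "u \<in> subs t \<Longrightarrow> 0 < occ u t"
  by (induction t) auto

lemma occ_eq_0_size: "size t < size u \<Longrightarrow> occ u t = 0"
  using occ_eq_0 size_subs[of u t] by fastforce

lemma occ_self [simp]: "occ t t = 1"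
  by (cases t) (auto simp: occ_eq_0_size)

lemma occ_kids: "u \<in> kids p \<Longrightarrow> occ p t \<le> occ u t"
proof (induction t)
  case (App l r)
  show ?case
  proof (cases "p = App l r")
    case True
    then have "u \<in> subs (App l r)" using App.prems by auto
    then show ?thesis using True occ_pos[of u "App l r"] by (simp del: occ.simps)
  qed (use App in auto)
next
  case (Pow b k)
  show ?case
  proof (cases "p = Pow b k")
    case True
    then have "u \<in> subs (Pow b k)" using Pow.prems by auto
    then show ?thesis using True occ_pos[of u "Pow b k"] by (simp del: occ.simps)
  qed (use Pow in auto)
qed auto

text \<open>The child of \<open>p\<close> that equals \<open>u\<close> contains no \<open>q\<close>,
  which is larger than \<open>u\<close>. It therefore counts in addition to the copies of
  \<open>u\<close> found below the occurrences of \<open>q\<close> in \<open>p\<close>.\<close>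

lemma occ_two_parents_aux:
  assumes "u \<in> kids p" "u \<in> kids q" "p \<noteq> q"
  shows "Suc (occ q p) \<le> occ u p"
proof -
  have 0: "occ q u = 0" using occ_eq_0_size size_kids[OF assms(2)] by blast
  show ?thesis
  proof (cases p)
    case (App l r)
    have "occ q l \<le> occ u l" "occ q r \<le> occ u r" using occ_kids[OF assms(2)] by auto
    moreover have "Suc (occ q l) \<le> occ u l \<or> Suc (occ q r) \<le> occ u r"
      using assms(1) 0 App by auto
    ultimately show ?thesis using App assms by auto
  qed (use assms 0 in auto)
qed

text \<open>An occurrence of \<open>u\<close> has a single parent occurrence, so the copies of
  \<open>u\<close> below \<open>p\<close> and those below \<open>q\<close> are different, even if
  one of \<open>p\<close>, \<open>q\<close> contains the other.\<close>

lemma occ_two_parents: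
  assumes "u \<in> kids p" "u \<in> kids q" "p \<noteq> q"
  shows "occ p t + occ q t \<le> occ u t"
proof (induction t)
  case (Chr a)
  then show ?case using assms by auto
next
  case (App l r)
  consider "App l r = p" | "App l r = q" | "App l r \<noteq> p" "App l r \<noteq> q" by blast
  then show ?case
  proof cases
    case 1
    then show ?thesis using occ_two_parents_aux[OF assms] occ_self[of p] by (simp del: occ.simps)
  next
    case 2
    then show ?thesis
      using occ_two_parents_aux[OF assms(2,1)] assms(3) occ_self[of q] by (simp del: occ.simps)
  qed (use App in auto)
next
  case (Pow b k)
  consider "Pow b k = p" | "Pow b k = q" | "Pow b k \<noteq> p" "Pow b k \<noteq> q" by blast
  then show ?case
  proof cases
    case 1
    then show ?thesis using occ_two_parents_aux[OF assms] occ_self[of p] by (simp del: occ.simps)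
  next
    case 2
    then show ?thesis
      using occ_two_parents_aux[OF assms(2,1)] assms(3) occ_self[of q] by (simp del: occ.simps)
  qed (use Pow in auto)
qed

text \<open>Occurrences of one tree are never nested, so they occupy disjoint stretches of the
  yield.\<close>

lemma occ_len: "slp_ok t \<Longrightarrow> occ u t * len u \<le> len t"
proof (induction t)
  case (App l r)
  then show ?case
    by (cases "App l r = u") (auto simp: occ_eq_0_size add_mult_distrib)
next
  case (Pow b k)
  show ?case
  proof (cases "Pow b k = u")
    case True
    then show ?thesis by (auto simp: occ_eq_0_size)
  next
    case False
    then have "occ u (Pow b k) * len u \<le> len b" using Pow by simp
    also have "\<dots> \<le> len (Pow b k)" using Pow.prems by simp
    finally show ?thesis .
  qed
qed auto

text \<open>Two numbers of at least class \<open>m\<close> add up to one of a higher class. Applied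
  to lengths it makes heavy children unique, applied to occurrence counts heavy parents.\<close>

lemma floor_log_add:
  assumes "0 < x" "0 < y" "m \<le> floor_log x" "m \<le> floor_log y"
  shows "Suc m \<le> floor_log (x + y)"
proof -
  have "(2 :: nat) ^ m \<le> 2 ^ floor_log x" "(2 :: nat) ^ m \<le> 2 ^ floor_log y"
    using assms by (simp_all add: power_increasing)
  then have "2 ^ m \<le> x" "2 ^ m \<le> y"
    using floor_log_exp2_le[OF assms(1)] floor_log_exp2_le[OF assms(2)] by linarith+
  then have "2 ^ Suc m \<le> x + y" by simp
  from floor_log_le_iff[OF this] show ?thesis by simp
qed

lemma floor_log_mult_power:
  assumes "0 < e" "e * 2 ^ m \<le> w"
  shows "floor_log e + m \<le> floor_log w"
proof -
  have "2 ^ (floor_log e + m) \<le> e * 2 ^ m"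
    using floor_log_exp2_le[of e] assms(1) by (simp add: power_add)
  then have "2 ^ (floor_log e + m) \<le> w" using assms(2) by simp
  from floor_log_le_iff[OF this] show ?thesis by simp
qed

section \<open>Heavy edges, by classes of length and of occurrence count\<close>

locale balancing =
  fixes R :: "'a slp"
  assumes R: "slp_ok R"
begin

definition llen :: "'a slp \<Rightarrow> nat" where "llen u = floor_log (len u)"
definition locc :: "'a slp \<Rightarrow> nat" where "locc u = floor_log (occ u R)"
text \<open>The potential of a descent: downwards, lengths do not grow and occurrence counts do not
  fall, so the key never rises. It is constant on heavy paths and drops on every light edge.\<close>

definition key :: "'a slp \<Rightarrow> nat" where "key u = llen u + (llen R - locc u)"

definition heavy :: "'a slp \<Rightarrow> 'a slp \<Rightarrow> bool" where
  "heavy p u \<longleftrightarrow> u \<in> kids p \<and> llen p = llen u \<and> locc p = locc u"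

text \<open>The number of occurrences of \<open>u\<close> that do not come from its heavy parent is at least \<open>e\<close>: these
  are the ways to enter the heavy path of \<open>u\<close> at \<open>u\<close>, and they add up to at most \<open>occ\<close> of the
  last node of the path.\<close>

definition entry :: "nat \<Rightarrow> 'a slp \<Rightarrow> bool" where
  "entry e u \<longleftrightarrow> 0 < e \<and> e \<le> occ u R \<and> (\<forall>p\<in>subs R. heavy p u \<longrightarrow> e + occ p R \<le> occ u R)"

lemma len_pos': "u \<in> subs R \<Longrightarrow> 0 < len u"
  using slp_ok_subs[OF R] len_pos by blast

lemma locc_le: "u \<in> subs R \<Longrightarrow> locc u \<le> llen R"
proof -
  assume u: "u \<in> subs R"
  have "occ u R * 1 \<le> occ u R * len u" by (intro mult_le_mono2 Suc_leI[OF len_pos'[OF u], folded One_nat_def])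
  also have "\<dots> \<le> len R" by (rule occ_len[OF R])
  finally show ?thesis unfolding locc_def llen_def by (simp add: floor_log_le_iff)
qed

lemma edge:
  assumes "p \<in> subs R" "u \<in> kids p"
  shows "u \<in> subs R" "llen u \<le> llen p" "locc p \<le> locc u"
  using kids_in_subs[OF assms(1)] assms len_kids[OF slp_ok_subs[OF R assms(1)]] occ_kids[OF assms(2)]
  unfolding llen_def locc_def by (auto intro: floor_log_le_iff)

lemma key_light:
  assumes "p \<in> subs R" "u \<in> kids p" "\<not> heavy p u"
  shows "key u < key p"
  using edge[OF assms(1,2)] locc_le[OF edge(1)[OF assms(1,2)]] assms(2,3)
  unfolding heavy_def key_def by linarith

lemma key_heavy: "heavy p u \<Longrightarrow> key u = key p"
  unfolding heavy_def key_def by simp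

text \<open>Two different heavy parents would contribute disjoint sets of occurrences of
  \<open>u\<close>, each of the class of \<open>u\<close>, and lift its count to the next
  class.\<close>

lemma heavy_parent_unique:
  assumes "heavy p u" "heavy q u" "p \<in> subs R" "q \<in> subs R"
  shows "p = q"
proof (rule ccontr)
  assume "p \<noteq> q"
  then have "occ p R + occ q R \<le> occ u R"
    using assms(1,2) occ_two_parents unfolding heavy_def by blast
  then have "floor_log (occ p R + occ q R) \<le> locc u" unfolding locc_def by (rule floor_log_le_iff)
  moreover have "Suc (locc u) \<le> floor_log (occ p R + occ q R)"
    by (rule floor_log_add) (use assms occ_pos in \<open>auto simp: heavy_def locc_def\<close>)
  ultimately show False by simp
qed

text \<open>A power, or a concatenation with two heavy children, would be in a higher length class
  than its child. Hence a heavy edge leaves a concatenation whose other child is light. The weight 0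
  is a placeholder.\<close>

lemma heavy_cases:
  assumes "heavy p u" "p \<in> subs R"
  obtains d c where "p = nest [(d, c, 0)] u" "c \<in> kids p" "\<not> heavy p c"
proof -
  have u: "u \<in> kids p" using assms(1) by (simp add: heavy_def)
  have llen: "llen p = llen u" using assms(1) by (simp add: heavy_def)
  have up: "0 < len u" using len_pos' edge(1)[OF assms(2) u] by blast
  show ?thesis
  proof (cases p)
    case (Chr a)
    then show ?thesis using u by simp
  next
    case (Pow b k)
    then have "2 < k" using slp_ok_subs[OF R assms(2)] by simp
    then have "len u + len u \<le> len p" using u Pow by (simp flip: mult_2)
    then have "floor_log (len u + len u) \<le> llen u"
      using llen unfolding llen_def by (metis floor_log_le_iff)
    moreover have "Suc (llen u) \<le> floor_log (len u + len u)"
      by (rule floor_log_add) (use up in \<open>auto simp: llen_def\<close>)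
    ultimately show ?thesis by simp
  next
    case (App l r)
    have lr: "0 < len l" "0 < len r" using len_pos' edge(1)[OF assms(2)] App by auto
    have not: "\<not> (heavy p l \<and> heavy p r)"
    proof
      assume h: "heavy p l \<and> heavy p r"
      have "Suc (llen p) \<le> floor_log (len l + len r)"
        by (rule floor_log_add) (use h lr in \<open>auto simp: heavy_def llen_def\<close>)
      then show False using App by (simp add: llen_def)
    qed
    show ?thesis
      using u App not assms(1) that[of False r] that[of True l] by auto
  qed
qed

text \<open>If \<open>u\<close> also has a heavy parent, it differs from \<open>p\<close>, and the
  occurrences below \<open>p\<close> are disjoint from those below the heavy parent.\<close>

lemma entry_light:
  assumes "p \<in> subs R" "u \<in> kids p" "\<not> heavy p u"
  shows "entry (occ p R) u"
  unfolding entry_def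
  using assms occ_pos[OF assms(1)] occ_kids[OF assms(2)] occ_two_parents[of u p _ R]
  by (auto simp: heavy_def)

lemma heavy_path_ex:
  assumes "u \<in> subs R"
  obtains its x where "u = nest its x"
    "\<And>i. i < length its \<Longrightarrow> heavy (nest (drop i its) x) (nest (drop (Suc i) its) x) \<and>
       side (its ! i) \<in> kids (nest (drop i its) x) \<and> \<not> heavy (nest (drop i its) x) (side (its ! i))"
    "\<And>v. \<not> heavy x v"
proof -
  have "\<exists>its x. u = nest its x \<and> (\<forall>i<length its. heavy (nest (drop i its) x) (nest (drop (Suc i) its) x) \<and>
       side (its ! i) \<in> kids (nest (drop i its) x) \<and> \<not> heavy (nest (drop i its) x) (side (its ! i))) \<and>
    (\<forall>v. \<not> heavy x v)"
    using assms
  proof (induction "size u" arbitrary: u rule: less_induct)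
    case less
    show ?case
    proof (cases "\<exists>v. heavy u v")
      case False
      then show ?thesis by (intro exI[of _ "[]"] exI[of _ u]) auto
    next
      case True
      then obtain v where v: "heavy u v" by blast
      then have vk: "v \<in> kids u" by (simp add: heavy_def)
      obtain its x where *: "v = nest its x"
        "\<forall>i<length its. heavy (nest (drop i its) x) (nest (drop (Suc i) its) x) \<and>
       side (its ! i) \<in> kids (nest (drop i its) x) \<and> \<not> heavy (nest (drop i its) x) (side (its ! i))"
        "\<forall>v. \<not> heavy x v"
        using less.hyps[OF size_kids[OF vk] edge(1)[OF less.prems vk]] by blast
      obtain d c where dc: "u = nest [(d, c, 0)] v" "c \<in> kids u" "\<not> heavy u c"
        using heavy_cases[OF v less.prems] by blast
      have u: "u = nest ((d, c, 0) # its) x" using dc(1) *(1) by simp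
      have "heavy (nest (drop i ((d, c, 0) # its)) x) (nest (drop (Suc i) ((d, c, 0) # its)) x) \<and>
        side (((d, c, 0) # its) ! i) \<in> kids (nest (drop i ((d, c, 0) # its)) x) \<and>
        \<not> heavy (nest (drop i ((d, c, 0) # its)) x) (side (((d, c, 0) # its) ! i))"
        if "i < length ((d, c, 0) # its)" for i
      proof (cases i)
        case 0
        then show ?thesis using u *(1) v dc(2,3) by (simp del: nest.simps(2))
      next
        case (Suc j)
        then show ?thesis using *(2) that by simp
      qed
      then show ?thesis using u *(3) by blast
    qed
  qed
  then show ?thesis using that by blast
qed

end


section \<open>Rebuilding one heavy path at a time\<close>

lemma lefts_rights_cong:
  assumes "list_all2 (\<lambda>x y. fst x = fst y \<and> yield (side x) = yield (side y)) xs ys"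
  shows "lefts xs = lefts ys \<and> rights xs = rights ys"
  using assms
proof (induction xs ys rule: list_all2_induct)
  case (Cons x xs y ys)
  then show ?case by (cases x; cases y) auto
qed auto

lemma sum_list_map_upt: "sum_list (map f [0..<p]) = (\<Sum>i<p. f i)"
  by (simp add: interv_sum_list_conv_sum_set_nat atLeast0LessThan)

lemma sum_side_nest: "(\<Sum>i<length xs. len (side (xs ! i))) \<le> len (nest xs x)"
proof (induction xs)
  case (Cons y ys)
  then show ?case
    by (cases y) (auto simp: sum.lessThan_Suc_shift simp del: sum.lessThan_Suc)
qed simp

lemma sum_increments:
  fixes f :: "nat \<Rightarrow> nat"
  assumes "\<And>i. Suc i < m \<Longrightarrow> f i \<le> f (Suc i)"
  shows "(\<Sum>i<m. f i - (if i = 0 then 0 else f (i - 1))) = (if m = 0 then 0 else f (m - 1))"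
  using assms
proof (induction m)
  case (Suc m)
  then show ?case by (cases m) auto
qed simp

context balancing
begin

text \<open>The height is bounded relative to a number \<open>e\<close> of entries: a node that is
  entered often sits near the root of the biased tree of its path. The term with \<open>locc\<close>
  and \<open>e\<close> is what makes the bound telescope over successive paths.\<close>

definition balanced_on :: "'a slp set \<Rightarrow> ('a slp \<Rightarrow> 'a slp) \<Rightarrow> 'a slp set \<Rightarrow> bool" where
  "balanced_on A bal N \<longleftrightarrow> finite N \<and> card N \<le> 6 * card A \<and> (\<forall>u\<in>A. yield (bal u) = yield u \<and>
     slp_ok (bal u) \<and> subs (bal u) \<subseteq> N \<and>
     (\<forall>e. entry e u \<longrightarrow> height (bal u) \<le> 15 * key u + 3 * (locc u - floor_log e) + 6))"

text \<open>The heavy path that starts at a largest node \<open>u0\<close> of maximal \<open>key\<close> is rebuilt on top of the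
  balanced trees of the remaining nodes, which are closed under children. The weight of a position
  combines the two halves of \<open>key\<close>: the entries at the position and the length of its side tree.\<close>

lemma balanced_on_peel:
  assumes A: "A \<subseteq> subs R" "\<And>u. u \<in> A \<Longrightarrow> kids u \<subseteq> A" "A \<noteq> {}"
    and IH: "\<And>B. B \<subset> A \<Longrightarrow> (\<And>u. u \<in> B \<Longrightarrow> kids u \<subseteq> B) \<Longrightarrow> \<exists>bal N. balanced_on B bal N"
  shows "\<exists>bal N. balanced_on A bal N"
proof -
  have fin: "finite A" using A(1) finite_subset finite_subs by blast
  define k where "k = Max (key ` A)"
  have kmax: "key u \<le> k" if "u \<in> A" for u unfolding k_def using fin that by simp
  define K where "K = {u \<in> A. key u = k}"
  have "k \<in> key ` A" unfolding k_def using fin A(3) by (intro Max_in) auto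
  then have K: "K \<noteq> {}" "finite K" unfolding K_def using fin by auto
  \<comment> \<open>Maximal size ensures that no remaining node has a heavy edge into
    \<open>u0\<close>, so the path is complete at its upper end.\<close>
  then obtain u0 where u0: "u0 \<in> K" "\<And>u. u \<in> K \<Longrightarrow> size u \<le> size u0"
  proof -
    have "Max (size ` K) \<in> size ` K" using K by (intro Max_in) auto
    then obtain u0 where "u0 \<in> K" "size u0 = Max (size ` K)" by (metis imageE)
    then show ?thesis using that[of u0] K by simp
  qed
  have u0A: "u0 \<in> A" "key u0 = k" using u0(1) unfolding K_def by auto
  then have "u0 \<in> subs R" using A(1) by auto
  then obtain its x where its0: "u0 = nest its x"
    and its: "\<And>i. i < length its \<Longrightarrow> heavy (nest (drop i its) x) (nest (drop (Suc i) its) x) \<and>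
       side (its ! i) \<in> kids (nest (drop i its) x) \<and> \<not> heavy (nest (drop i its) x) (side (its ! i))"
    and x: "\<And>v. \<not> heavy x v"
    using heavy_path_ex by blast
  define p where "p = length its"
  define v where "v i = nest (drop i its) x" for i
  have v0: "v 0 = u0" and vp: "v p = x" unfolding v_def p_def using its0 by auto
  have hv: "heavy (v i) (v (Suc i))" if "i < p" for i using its[of i] that unfolding v_def p_def by blast
  have sk: "side (its ! i) \<in> kids (v i)" and sl: "\<not> heavy (v i) (side (its ! i))" if "i < p" for i
    using its[of i] that unfolding v_def p_def by blast+
  have vA: "v i \<in> A \<and> key (v i) = k \<and> llen (v i) = llen u0 \<and> locc (v i) = locc u0" if "i \<le> p" for i
    using that
  proof (induction i)
    case 0
    then show ?case using u0A v0 by simp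
  next
    case (Suc i)
    then have "heavy (v i) (v (Suc i))" using hv by simp
    then show ?case using Suc A(2)[of "v i"] key_heavy by (auto simp: heavy_def)
  qed
  have vR: "v i \<in> subs R" if "i \<le> p" for i using vA[OF that] A(1) by auto
  have vsize: "i < j \<Longrightarrow> j \<le> p \<Longrightarrow> size (v j) < size (v i)" for i j
  proof (induction j)
    case (Suc j)
    have "size (v (Suc j)) < size (v j)" using hv[of j] Suc.prems size_kids by (auto simp: heavy_def)
    then show ?case using Suc by (cases "i = j") auto
  qed simp
  have inj: "inj_on v {..p}"
    by (rule linorder_inj_onI') (use vsize in fastforce)
  define V where "V = v ` {..p}"
  have cV: "card V = Suc p" unfolding V_def using card_image[OF inj] by simp
  have VA: "V \<subseteq> A" using vA unfolding V_def by auto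
  have light: "c \<in> A - V" "key c < k" if "i \<le> p" "c \<in> kids (v i)" "\<not> heavy (v i) c" for i c
  proof -
    show "key c < k" using key_light[OF vR that(2,3)] vA that(1) by auto
    then show "c \<in> A - V" using A(2) vA that(1,2) unfolding V_def by fastforce
  qed
  \<comment> \<open>An edge from a remaining node into the path would be heavy, as no key in
    \<open>A\<close> exceeds \<open>k\<close>. Its source would then be the unique heavy parent,
    which lies on the path, or a node of key \<open>k\<close> larger than \<open>u0\<close>.\<close>
  have closed: "kids q \<subseteq> A - V" if q: "q \<in> A - V" for q
  proof
    fix c assume c: "c \<in> kids q"
    have "c \<notin> V"
    proof
      assume "c \<in> V"
      then obtain i where i: "i \<le> p" "c = v i" unfolding V_def by auto
      have qR: "q \<in> subs R" using q A(1) by auto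
      have "heavy q c"
        using key_light[OF qR c] kmax[of q] q vA[OF i(1)] i(2) by fastforce
      then have "key q = k" using vA[OF i(1)] i(2) key_heavy by auto
      show False
      proof (cases i)
        case 0
        then have "size u0 < size q" using size_kids[OF c] i(2) v0 by simp
        moreover have "q \<in> K" using q \<open>key q = k\<close> unfolding K_def by auto
        ultimately show False using u0(2) by fastforce
      next
        case (Suc j)
        then have "q = v j" using heavy_parent_unique[OF \<open>heavy q c\<close> _ qR vR] hv[of j] i by auto
        then show False using q i(1) Suc unfolding V_def by auto
      qed
    qed
    then show "c \<in> A - V" using A(2) q c by auto
  qed
  have "V \<noteq> {}" by (auto simp: V_def)
  then have "A - V \<subset> A" using VA by blast
  from IH[OF this closed] obtain bal N where "balanced_on (A - V) bal N" by blast
  then have N: "finite N" "card N \<le> 6 * card (A - V)"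
    and bal: "\<And>u. u \<in> A - V \<Longrightarrow> yield (bal u) = yield u \<and> slp_ok (bal u) \<and> subs (bal u) \<subseteq> N"
    and bal_height: "\<And>u e. u \<in> A - V \<Longrightarrow> entry e u \<Longrightarrow>
      height (bal u) \<le> 15 * key u + 3 * (locc u - floor_log e) + 6"
    unfolding balanced_on_def by auto
  define a where "a = llen u0"
  define b where "b = locc u0"
  have bR: "b \<le> llen R" using locc_le[OF vR[of 0]] v0 unfolding b_def by simp
  have k: "k = a + (llen R - b)" using u0A(2) unfolding key_def a_def b_def by simp
  \<comment> \<open>Origin of the factor 15: the two differences of classes sum to
    \<open>k - key c\<close>, each unit costs three levels, and the constants 6 + 6 are covered
    because a light edge loses at least one unit; 3 + 12 = 15.\<close>
  have child_height: "height (bal c) + 3 * (a + 2 - llen c) \<le> 15 * k \<and> height (bal c) < 15 * k"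
    if i: "i \<le> p" and c: "c \<in> kids (v i)" "\<not> heavy (v i) c" for i c
  proof -
    have "floor_log (occ (v i) R) = b" using vA[OF i] by (simp add: b_def locc_def)
    then have "height (bal c) \<le> 15 * key c + 3 * (locc c - b) + 6"
      using bal_height[OF light(1)[OF i c] entry_light[OF vR[OF i] c]] by simp
    moreover have "llen c \<le> a" "b \<le> locc c" "locc c \<le> llen R"
      using edge[OF vR[OF i] c(1)] vA[OF i] locc_le unfolding a_def b_def by auto
    moreover have "key c < k" by (rule light(2)[OF i c])
    moreover have "key c = llen c + (llen R - locc c)" by (simp add: key_def)
    ultimately show ?thesis using k bR by linarith
  qed
  \<comment> \<open>The entries sum to less than \<open>2 ^ (b + 1)\<close> and the lengths to less
    than \<open>2 ^ (a + 1)\<close>. The crosswise factors give both sums the bound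
    \<open>2 ^ (a + b + 2)\<close>, whence \<open>M = a + b + 3\<close>. At position 0 all
    occurrences of \<open>u0\<close> count as entries.\<close>
  define w where "w i = (occ (v i) R - (if i = 0 then 0 else occ (v (i - 1)) R)) * 2 ^ (a + 1) +
    len (side (its ! i)) * 2 ^ (b + 1)" for i
  define xs where "xs = map (\<lambda>i. (fst (its ! i), bal (side (its ! i)), w i)) [0..<p]"
  define M where "M = a + b + 3"
  have xs_nth: "xs ! i = (fst (its ! i), bal (side (its ! i)), w i)" if "i < p" for i
    using that unfolding xs_def by simp
  have lxs: "length xs = p" unfolding xs_def by simp
  have sum_w: "sum_list (map weight xs) < 2 ^ M"
  proof -
    let ?P = "\<Sum>i<p. occ (v i) R - (if i = 0 then 0 else occ (v (i - 1)) R)"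
    let ?Q = "\<Sum>i<p. len (side (its ! i))"
    have "?P = (if p = 0 then 0 else occ (v (p - 1)) R)"
    proof (rule sum_increments[of p "\<lambda>i. occ (v i) R"])
      fix i assume "Suc i < p"
      then have "v (Suc i) \<in> kids (v i)" using hv[of i] by (simp add: heavy_def)
      then show "occ (v i) R \<le> occ (v (Suc i)) R" by (rule occ_kids)
    qed
    also have "\<dots> < 2 ^ (b + 1)"
      using vA[of "p - 1"] floor_log_exp2_gt[of "occ (v (p - 1)) R"] by (simp add: b_def locc_def)
    finally have P: "?P * 2 ^ (a + 1) < 2 ^ (b + 1) * 2 ^ (a + 1)"
      by (intro mult_less_mono1) auto
    have "?Q \<le> len u0" unfolding its0 p_def by (rule sum_side_nest)
    also have "\<dots> < 2 ^ (a + 1)"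
      using floor_log_exp2_gt[of "len u0"] by (simp add: a_def llen_def)
    finally have Q: "?Q * 2 ^ (b + 1) < 2 ^ (a + 1) * 2 ^ (b + 1)"
      by (intro mult_less_mono1) auto
    have "sum_list (map weight xs) = (\<Sum>i<p. w i)"
      unfolding xs_def by (simp add: comp_def sum_list_map_upt)
    also have "\<dots> = ?P * 2 ^ (a + 1) + ?Q * 2 ^ (b + 1)"
      unfolding w_def sum.distrib sum_distrib_right by simp
    also have "\<dots> < 2 ^ (b + 1) * 2 ^ (a + 1) + 2 ^ (a + 1) * 2 ^ (b + 1)"
      by (rule add_strict_mono[OF P Q])
    also have "\<dots> = 2 ^ M" unfolding M_def by (simp add: power_add)
    finally show ?thesis .
  qed
  have fits: "\<forall>y\<in>set xs. fits N M (15 * k) y"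
  proof
    fix y assume "y \<in> set xs"
    then obtain i where i: "i < p" "y = xs ! i" using lxs by (metis in_set_conv_nth)
    let ?c = "side (its ! i)"
    have c: "?c \<in> A - V" using light(1)[OF _ sk sl] i(1) by auto
    have pos: "0 < len ?c" using c A(1) len_pos' by auto
    have "floor_log (len ?c) + (b + 1) \<le> floor_log (w i)"
      by (rule floor_log_mult_power[OF pos]) (simp add: w_def)
    then have "M - floor_log (w i) \<le> a + 2 - llen ?c" unfolding M_def llen_def by linarith
    moreover have "height (bal ?c) + 3 * (a + 2 - llen ?c) \<le> 15 * k"
      using child_height[OF _ sk sl] i(1) by auto
    ultimately have "height (bal ?c) + 3 * (M - floor_log (w i)) \<le> 15 * k" by linarith
    moreover have "0 < w i" using pos by (simp add: w_def)
    ultimately show "fits N M (15 * k) y"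
      unfolding i(2) fits_def using bal[OF c] by (simp add: xs_nth[OF i(1)])
  qed
  obtain N1 where N1: "finite N1" "card N1 \<le> 3 * p"
    and S1: "\<And>t e X. 15 * k \<le> e \<Longrightarrow> good X e t \<Longrightarrow> \<exists>S N'. finite N' \<and> card N' \<le> 3 * p \<and>
      (\<forall>i<p. good (N1 \<union> N' \<union> N \<union> X) (e + 3 * (M - floor_log (weight (xs ! i)))) (S i) \<and>
         yield (S i) = yield (nest (drop i xs) t))"
    using biased_trees_ex[OF sum_w fits] unfolding lxs by metis
  \<comment> \<open>The last node of the path has only light children; these are already balanced,
    so it is kept as it is, be it a leaf, a concatenation or a power.\<close>
  define core where "core = (case x of Chr a \<Rightarrow> Chr a | App l r \<Rightarrow> App (bal l) (bal r) | Pow y j \<Rightarrow> Pow (bal y) j)"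
  have xk: "c \<in> A - V" "height (bal c) < 15 * k" if "c \<in> kids x" for c
    using light(1)[of p c] child_height[of p c] vp x that by auto
  have xok: "slp_ok x" using vR[of p] vp slp_ok_subs[OF R] by simp
  have core: "good (insert core N) (15 * k) core" "yield core = yield x"
  proof -
    have c: "yield (bal c) = yield c" "slp_ok (bal c)" "subs (bal c) \<subseteq> N" "height (bal c) < 15 * k"
      if "c \<in> kids x" for c
      using xk[OF that] bal[of c] by auto
    show "good (insert core N) (15 * k) core"
    proof (cases x)
      case (App l r)
      then show ?thesis using c[of l] c[of r] unfolding core_def good_def by auto
    next
      case (Pow y j)
      then show ?thesis using c[of y] xok unfolding core_def good_def by auto
    qed (auto simp: core_def good_def)
    show "yield core = yield x" using c unfolding core_def by (cases x) auto
  qed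
  obtain S N2 where N2: "finite N2" "card N2 \<le> 3 * p"
    and S: "\<And>i. i < p \<Longrightarrow> good (N1 \<union> N2 \<union> N \<union> insert core N) (15 * k + 3 * (M - floor_log (w i))) (S i)"
      "\<And>i. i < p \<Longrightarrow> yield (S i) = yield (nest (drop i xs) core)"
    using S1[OF order_refl core(1)] xs_nth by (metis (no_types, lifting) snd_conv)
  have yS: "yield (S i) = yield (v i)" if "i < p" for i
  proof -
    have "list_all2 (\<lambda>x y. fst x = fst y \<and> yield (side x) = yield (side y)) (drop i xs) (drop i its)"
      unfolding list_all2_conv_all_nth
      using lxs that light(1)[OF _ sk sl] bal by (auto simp: xs_nth p_def)
    from lefts_rights_cong[OF this] show ?thesis
      unfolding S(2)[OF that] v_def yield_nest core(2) by simp
  qed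
  define T where "T i = (if i < p then S i else core)" for i
  define N' where "N' = N \<union> (insert core (N1 \<union> N2))"
  define bal' where "bal' u = (if u \<in> V then T (the_inv_into {..p} v u) else bal u)" for u
  have bal'_v: "bal' (v i) = T i" if "i \<le> p" for i
    using that the_inv_into_f_f[OF inj] unfolding bal'_def V_def by auto
  have "card (insert core (N1 \<union> N2)) \<le> Suc (card (N1 \<union> N2))"
    using N1(1) N2(1) by (simp add: card_insert_if)
  \<comment> \<open>The \<open>p\<close> items cost three nodes each for the side trees and three
    each for the suffixes; together with \<open>core\<close> this is at most
    \<open>6 * Suc p\<close>.\<close>
  then have "card N' \<le> 6 * card (A - V) + 6 * Suc p"
    unfolding N'_def using card_Un_le[of N "insert core (N1 \<union> N2)"] card_Un_le[of N1 N2] N(2) N1(2) N2(2)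
    by simp
  also have "\<dots> = 6 * card A"
    using card_Diff_subset[of V A] VA cV fin card_mono[OF fin VA] finite_subset[OF VA fin] by simp
  finally have "card N' \<le> 6 * card A" .
  moreover have "finite N'" unfolding N'_def using N N1 N2 by simp
  moreover have "yield (bal' u) = yield u \<and> slp_ok (bal' u) \<and> subs (bal' u) \<subseteq> N' \<and>
     (\<forall>e. entry e u \<longrightarrow> height (bal' u) \<le> 15 * key u + 3 * (locc u - floor_log e) + 6)" if "u \<in> A" for u
  proof (cases "u \<in> V")
    case False
    then have u: "u \<in> A - V" "bal' u = bal u" using that by (auto simp: bal'_def)
    then show ?thesis using bal[OF u(1)] bal_height[OF u(1)] unfolding N'_def by auto
  next
    case True
    then obtain i where i: "i \<le> p" "u = v i" unfolding V_def by auto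
    have b': "bal' u = T i" using bal'_v i by simp
    have ku: "key u = k" "locc u = b" using vA[OF i(1)] i(2) b_def by auto
    show ?thesis
    proof (cases "i < p")
      case False
      then have "bal' u = core" "u = x" using b' i vp T_def by auto
      then show ?thesis using core ku unfolding good_def N'_def by auto
    next
      case True
      have "bal' u = S i" using b' True T_def by simp
      moreover have "height (S i) \<le> 15 * k + 3 * (b - floor_log e) + 6" if e: "entry e u" for e
      proof -
        have "e \<le> occ (v i) R - (if i = 0 then 0 else occ (v (i - 1)) R)"
        proof (cases i)
          case 0
          then show ?thesis using e i(2) by (simp add: entry_def)
        next
          case (Suc j)
          then have "heavy (v j) u" "v j \<in> subs R" using hv[of j] vR[of j] i True by auto
          then have "e + occ (v j) R \<le> occ (v i) R" using e i(2) unfolding entry_def by auto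
          then show ?thesis using Suc by simp
        qed
        then have "e * 2 ^ (a + 1) \<le> w i" unfolding w_def by (intro trans_le_add1 mult_le_mono1)
        then have "floor_log e + (a + 1) \<le> floor_log (w i)"
          by (intro floor_log_mult_power) (use e in \<open>auto simp: entry_def\<close>)
        \<comment> \<open>The exponent \<open>M\<close> exceeds \<open>a + b\<close> by 3 and the
          factor of the entries contributes \<open>a + 1\<close>. The difference of 2, at three
          levels each, is the summand 6 of the height bound.\<close>
        then have "M - floor_log (w i) \<le> b - floor_log e + 2" unfolding M_def by linarith
        moreover have "height (S i) \<le> 15 * k + 3 * (M - floor_log (w i))"
          using S(1)[OF True] by (simp add: good_def)
        ultimately show ?thesis by linarith
      qed
      ultimately show ?thesis
        using S(1)[OF True] yS[OF True] i(2) ku unfolding good_def N'_def by auto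
    qed
  qed
  ultimately have "balanced_on A bal' N'" unfolding balanced_on_def by blast
  then show ?thesis by blast
qed

lemma balanced_on_ex:
  assumes "A \<subseteq> subs R" "\<And>u. u \<in> A \<Longrightarrow> kids u \<subseteq> A"
  shows "\<exists>bal N. balanced_on A bal N"
  using finite_subset[OF assms(1) finite_subs] assms
proof (induction A rule: finite_psubset_induct)
  case (psubset A)
  show ?case
  proof (cases "A = {}")
    case True
    then have "balanced_on A id {}" by (simp add: balanced_on_def)
    then show ?thesis by blast
  next
    case False
    show ?thesis
    proof (rule balanced_on_peel[OF psubset.prems False])
      fix B assume "B \<subset> A" "\<And>u. u \<in> B \<Longrightarrow> kids u \<subseteq> B"
      then show "\<exists>bal N. balanced_on B bal N" using psubset by (meson order_trans psubset_imp_subset)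
    qed
  qed
qed

text \<open>The root occurs once and has no parent, so \<open>entry 1 R\<close> holds and its
  occurrence class is 0. The term with \<open>e\<close> vanishes and the key is twice the length
  class, which turns 15 into 30.\<close>

lemma balanced_tree_ex:
  obtains t where "yield t = yield R" "slp_ok t" "card (subs t) \<le> 6 * card (subs R)"
    "height t \<le> 30 * floor_log (len R) + 6"
proof -
  obtain bal N where *: "balanced_on (subs R) bal N"
    using balanced_on_ex[OF subset_refl kids_in_subs] by blast
  have "\<not> heavy p R" if "p \<in> subs R" for p
    using size_kids[of R p] size_subs[OF that] by (auto simp: heavy_def)
  then have "entry 1 R" by (simp add: entry_def)
  then have "height (bal R) \<le> 15 * key R + 6"
    using * unfolding balanced_on_def by (fastforce simp: locc_def)
  moreover have "key R \<le> 2 * floor_log (len R)" by (simp add: key_def llen_def)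
  moreover have "card (subs (bal R)) \<le> 6 * card (subs R)"
    using * card_mono[of N "subs (bal R)"] unfolding balanced_on_def by (auto intro: order_trans)
  ultimately show ?thesis using * that[of "bal R"] unfolding balanced_on_def by auto
qed

end


section \<open>Weakest preconditions with running time\<close>

text \<open>The postcondition receives the exact number of steps, so that result and running time
  are established in one pass.\<close>

definition wp :: "nat \<Rightarrow> com option \<Rightarrow> com \<Rightarrow> (nat \<Rightarrow> state \<Rightarrow> bool) \<Rightarrow> state \<Rightarrow> bool" where
  "wp W sub c Q s \<longleftrightarrow> (\<exists>t s'. exec W sub c s t s' \<and> Q t s')"

inductive_cases exec_ConstE: "exec W sub (Const d c) s t s'"
inductive_cases exec_MoveE: "exec W sub (Move d a) s t s'"
inductive_cases exec_BinE: "exec W sub (Bin f d a b) s t s'"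
inductive_cases exec_LoadE: "exec W sub (Load d a) s t s'"
inductive_cases exec_SeqE: "exec W sub (Seq c1 c2) s t s'"
inductive_cases exec_IfE: "exec W sub (If a c1 c2) s t s'"

lemma wp_Const: "wp W sub (Const d c) Q (r, m) = Q 1 (r(d := c mod 2 ^ W), m)"
  unfolding wp_def by (auto elim!: exec_ConstE intro: exec_Const[unfolded One_nat_def])

lemma wp_Move: "wp W sub (Move d a) Q (r, m) = Q 1 (r(d := r a), m)"
  unfolding wp_def by (auto elim!: exec_MoveE intro: exec_Move[unfolded One_nat_def])

lemma wp_Bin: "wp W sub (Bin f d a b) Q (r, m) = Q 1 (r(d := eval_op W f (r a) (r b)), m)"
  unfolding wp_def by (auto elim!: exec_BinE intro: exec_Bin[unfolded One_nat_def])

lemma wp_Load: "wp W sub (Load d a) Q (r, m) = Q 1 (r(d := m (r a)), m)"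
  unfolding wp_def by (auto elim!: exec_LoadE intro: exec_Load[unfolded One_nat_def])

lemma wp_Seq: "wp W sub (Seq c1 c2) Q = wp W sub c1 (\<lambda>t1. wp W sub c2 (\<lambda>t2. Q (t1 + t2)))"
  unfolding wp_def fun_eq_iff by (blast elim!: exec_SeqE intro: exec_Seq)

lemma wp_If: "wp W sub (If a c1 c2) Q (r, m) =
    (if r a \<noteq> 0 then wp W sub c1 (\<lambda>t. Q (t + 1)) (r, m) else wp W sub c2 (\<lambda>t. Q (t + 1)) (r, m))"
proof -
  have "exec W sub (If a c1 c2) (r, m) t s \<longleftrightarrow>
    (\<exists>t'. t = t' + 1 \<and> exec W sub (if r a \<noteq> 0 then c1 else c2) (r, m) t' s)" for t s
    by (auto elim!: exec_IfE intro: exec_If_True[of r a, unfolded Suc_eq_plus1[symmetric]]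
        exec_If_False[of r a, unfolded Suc_eq_plus1[symmetric]])
  then show ?thesis unfolding wp_def by auto
qed

lemma wp_While_False: "r a = 0 \<Longrightarrow> Q 1 (r, m) \<Longrightarrow> wp W sub (While a c) Q (r, m)"
  unfolding wp_def by (blast intro: exec_While_False)

lemma wp_While_True:
  "r a \<noteq> 0 \<Longrightarrow> wp W sub c (\<lambda>t1. wp W sub (While a c) (\<lambda>t2. Q (t1 + t2 + 1))) (r, m) \<Longrightarrow>
    wp W sub (While a c) Q (r, m)"
  unfolding wp_def by (blast intro: exec_While_True)

lemma wp_Call:
  assumes "outputs W None H [r a, r b, r p, r q] [] t v" "Q (t + 1) (r(d := v), m)"
  shows "wp W (Some H) (Call d a b p q) Q (r, m)"
  using assms unfolding wp_def outputs_def by (blast intro: exec_Call)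

lemmas wp_simps = wp_Const wp_Move wp_Bin wp_Load wp_Seq wp_If

text \<open>Step counts are brought into a common form by unfolding small numerals, so that costs
  written as different sums agree syntactically under \<open>Q\<close>.\<close>

lemma numeral_add_Suc:
  fixes k :: nat
  shows "2 + k = Suc (Suc (k))"
  "3 + k = Suc (Suc (Suc (k)))"
  "4 + k = Suc (Suc (Suc (Suc (k))))"
  "5 + k = Suc (Suc (Suc (Suc (Suc (k)))))"
  "6 + k = Suc (Suc (Suc (Suc (Suc (Suc (k))))))"
  "7 + k = Suc (Suc (Suc (Suc (Suc (Suc (Suc (k)))))))"
  "8 + k = Suc (Suc (Suc (Suc (Suc (Suc (Suc (Suc (k))))))))"
  "9 + k = Suc (Suc (Suc (Suc (Suc (Suc (Suc (Suc (Suc (k)))))))))"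
  "10 + k = Suc (Suc (Suc (Suc (Suc (Suc (Suc (Suc (Suc (Suc (k))))))))))"
  "11 + k = Suc (Suc (Suc (Suc (Suc (Suc (Suc (Suc (Suc (Suc (Suc (k)))))))))))"
  "12 + k = Suc (Suc (Suc (Suc (Suc (Suc (Suc (Suc (Suc (Suc (Suc (Suc (k))))))))))))"
  by simp_all

section \<open>Word arithmetic and powers of strings\<close>

lemma eval_Sub:
  assumes "b \<le> a" "a < 2 ^ W"
  shows "eval_op W Sub a b = a - b"
proof -
  have "int a - int b = int (a - b)" using assms(1) by simp
  moreover have "int (a - b) < int (2 ^ W)"
    using assms by (simp only: of_nat_less_iff less_imp_diff_less)
  then have "int (a - b) mod 2 ^ W = int (a - b)"
    by (intro mod_pos_pos_trivial) simp_all
  ultimately show ?thesis by (simp only: eval_op.simps nat_int)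
qed

text \<open>The number of binary digits, none for 0: the iterations of repeated squaring.\<close>

definition bits :: "nat \<Rightarrow> nat" where
  "bits q = (if q = 0 then 0 else Suc (floor_log q))"

lemma bits_rec: "q \<noteq> 0 \<Longrightarrow> bits q = Suc (bits (q div 2))"
  unfolding bits_def by (subst floor_log.simps) (auto simp: div_eq_0_iff)

lemma bits_le: "bits q \<le> Suc (floor_log q)"
  by (simp add: bits_def)

abbreviation rep :: "nat \<Rightarrow> 'a list \<Rightarrow> 'a list" where
  "rep q x \<equiv> concat (replicate q x)"

lemma rep_add: "rep (p + q) x = rep p x @ rep q x"
  by (simp add: replicate_add)

lemma rep_commute: "rep q x @ x = x @ rep q x"
  by (induction q) auto

lemma rep_double: "rep q (x @ x) = rep (2 * q) x"
  by (induction q) auto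

abbreviation (input) skip :: com where "skip \<equiv> Move 35 35"

section \<open>The query program\<close>

text \<open>Registers 30 and 31 hold the code and the length of a string \<open>x\<close>, registers 33 and 34 those of
  an accumulator; register 22 holds 2. The program multiplies the accumulator from the left (if \<open>pre\<close>)
  or from the right by the power of \<open>x\<close> whose exponent is in register 32.\<close>

definition power_body :: "bool \<Rightarrow> com" where
  "power_body pre =
     Seq (Bin Mod 35 32 22)
     (Seq (If 35 (Seq (if pre then Call 33 30 33 31 34 else Call 33 33 30 34 31) (Bin Add 34 34 31)) skip)
     (Seq (Bin Div 32 32 22)
       (If 32 (Seq (Call 30 30 30 31 31) (Bin Add 31 31 31)) skip)))"

definition power_com :: "bool \<Rightarrow> com" where
  "power_com pre = While 32 (power_body pre)"

locale combination =
  fixes W :: nat and enc :: "'b \<Rightarrow> nat" and n :: nat and f :: "'a list \<Rightarrow> 'b"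
    and h :: "'b \<Rightarrow> 'b \<Rightarrow> nat \<Rightarrow> nat \<Rightarrow> 'b" and H :: com and T :: nat
  assumes comp: "computes_combination W enc n f h H T"
    and hom: "f (x @ y) = h (f x) (f y) (length x) (length y)"
    and nW: "n < 2 ^ W"
begin

abbreviation code :: "'a list \<Rightarrow> nat" where "code x \<equiv> enc (f x)"

lemma call_ex:
  assumes "length x + length y \<le> n"
  shows "\<exists>t\<le>T. outputs W None H [code x, code y, length x, length y] [] t (code (x @ y))"
  using comp assms unfolding computes_combination_def hom by blast

lemma wp_combine:
  assumes "r a = code x" "r b = code y" "r p = length x" "r q = length y" "length x + length y \<le> n"
    and "\<And>t. t \<le> T + 1 \<Longrightarrow> Q t (r(d := code (x @ y)), m)"
  shows "wp W (Some H) (Call d a b p q) Q (r, m)"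
  using call_ex[OF assms(5)] assms(1-4,6) by (auto intro!: wp_Call)

definition acc :: "(nat \<Rightarrow> nat) \<Rightarrow> 'a list \<Rightarrow> bool" where
  "acc r y \<longleftrightarrow> r 33 = code y \<and> r 34 = length y"

text \<open>An iteration makes at most two calls, hence the factor \<open>2 * T + 12\<close> per
  binary digit. All registers below 30 survive, so the descents can keep their state there.\<close>

lemma wp_power_com:
  assumes "r 32 = q" "0 < q \<Longrightarrow> r 30 = code x \<and> r 31 = length x" "acc r y" "r 22 = 2"
    and "length y + q * length x \<le> n"
    and "\<And>t r'. t \<le> (2 * T + 12) * bits q + 1 \<Longrightarrow>
      acc r' (if pre then rep q x @ y else y @ rep q x) \<Longrightarrow>
      (\<And>k. k < 30 \<Longrightarrow> r' k = r k) \<Longrightarrow> Q t (r', m)"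
  shows "wp W (Some H) (power_com pre) Q (r, m)"
  using assms
proof (induction q arbitrary: r x y Q rule: less_induct)
  case (less q)
  show ?case
  proof (cases "q = 0")
    case True
    show ?thesis
      unfolding power_com_def by (rule wp_While_False) (use less.prems True in \<open>auto simp: bits_def\<close>)
  next
    case False
    define y' where "y' = (if odd q then (if pre then x @ y else y @ x) else y)"
    define x' where "x' = (if q div 2 = 0 then x else x @ x)"
    have r: "r 32 = q" "r 30 = code x" "r 31 = length x" "r 33 = code y" "r 34 = length y" "r 22 = 2"
      using less.prems False by (auto simp: acc_def)
    have q: "q * length x = (q div 2) * (length x + length x) + (q mod 2) * length x"
      using arg_cong[OF div_mult_mod_eq[of q 2], of "\<lambda>k. k * length x"]
      by (simp only: add_mult_distrib mult.assoc mult_2)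
    note len0 = less.prems(5)[unfolded q]
    have len: "length y' + (q div 2) * length x' \<le> n"
      using len0 unfolding y'_def x'_def by (auto simp: odd_iff_mod_2_eq_one)
    \<comment> \<open>Powers of one string commute, so a factor \<open>x\<close> for an odd digit
      may be multiplied in before the higher powers on either side.\<close>
    have result: "(if pre then rep (q div 2) x' @ y' else y' @ rep (q div 2) x') =
      (if pre then rep q x @ y else y @ rep q x)"
    proof -
      have "rep q x = rep (2 * (q div 2)) x @ rep (q mod 2) x"
        unfolding rep_add[symmetric] by simp
      moreover have "rep (q div 2) x' = rep (2 * (q div 2)) x" unfolding x'_def by (simp add: rep_double)
      moreover have "rep (2 * (q div 2)) x @ x = x @ rep (2 * (q div 2)) x" by (rule rep_commute)
      ultimately show ?thesis
        unfolding y'_def by (auto simp: odd_iff_mod_2_eq_one)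
    qed
    \<comment> \<open>The square is formed only if a higher digit remains. Then it still fits into
      length \<open>n\<close>, beyond which nothing is known about the subroutine.\<close>
    have len2: "q div 2 \<noteq> 0 \<Longrightarrow> length x + length x \<le> n"
      using len0 by (cases "q div 2") auto
    have len1: "odd q \<Longrightarrow> length x + length y \<le> n"
      using len0 by (auto simp: odd_iff_mod_2_eq_one)
    have next_iter: "wp W (Some H) (power_com pre) (\<lambda>t2. Q (t1 + t2 + 1)) (r', m)"
      if t1: "t1 \<le> 2 * T + 10" and "r' 32 = q div 2" "q div 2 \<noteq> 0 \<Longrightarrow> r' 30 = code x' \<and> r' 31 = length x'"
        "acc r' y'" "\<And>k. k < 30 \<Longrightarrow> r' k = r k" for t1 r'
    proof (rule less.IH[of "q div 2" r' x' y'])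
      show "q div 2 < q" using False by simp
      show "r' 22 = 2" using that(5)[of 22] r by simp
      fix t r''
      assume t: "t \<le> (2 * T + 12) * bits (q div 2) + 1"
        and a: "acc r'' (if pre then rep (q div 2) x' @ y' else y' @ rep (q div 2) x')"
        and keep: "\<And>k. k < 30 \<Longrightarrow> r'' k = r' k"
      show "Q (t1 + t + 1) (r'', m)"
      proof (rule less.prems(6))
        show "t1 + t + 1 \<le> (2 * T + 12) * bits q + 1"
          using t t1 bits_rec[OF False] by simp
        show "acc r'' (if pre then rep q x @ y else y @ rep q x)" using a result by metis
        show "\<And>k. k < 30 \<Longrightarrow> r'' k = r k" using keep that(5) by simp
      qed
    qed (use that len in auto)
    have tail: "wp W (Some H) (Seq (Bin Div 32 32 22) (If 32 (Seq (Call 30 30 30 31 31) (Bin Add 31 31 31)) skip))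
        (\<lambda>t2. wp W (Some H) (power_com pre) (\<lambda>t3. Q (t1 + t2 + t3 + 1))) (r', m)"
      if t1: "t1 \<le> T + 4" and r': "r' 32 = q" "r' 30 = code x" "r' 31 = length x" "r' 22 = 2" "acc r' y'"
        and keep: "\<And>k. k < 30 \<Longrightarrow> r' k = r k" for t1 r'
    proof (cases "q div 2 = 0")
      case True
      have "wp W (Some H) (power_com pre) (\<lambda>t2. Q (t1 + 3 + t2 + 1)) (r'(32 := 0, 35 := r' 35), m)"
        by (rule next_iter) (use True r' t1 keep in \<open>auto simp: acc_def\<close>)
      then show ?thesis using r' True by (simp add: wp_simps numeral_add_Suc add.assoc)
    next
      case False
      have ov: "length x + length x < 2 ^ W" using len2[OF False] nW by simp
      have "wp W (Some H) (Call 30 30 30 31 31) (\<lambda>t s. wp W (Some H) (Bin Add 31 31 31)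
        (\<lambda>t' s. wp W (Some H) (power_com pre) (\<lambda>t3. Q (t1 + (1 + (t + t' + 1)) + t3 + 1)) s) s) (r'(32 := q div 2), m)"
      proof (rule wp_combine[of _ _ x _ x])
        fix t assume t: "t \<le> T + 1"
        have "wp W (Some H) (power_com pre) (\<lambda>t2. Q ((t1 + t + 3) + t2 + 1))
          (r'(32 := q div 2, 30 := code (x @ x), 31 := length x + length x), m)"
          by (rule next_iter) (use False r' t1 t keep in \<open>auto simp: acc_def x'_def\<close>)
        then show "wp W (Some H) (Bin Add 31 31 31)
          (\<lambda>t' s. wp W (Some H) (power_com pre) (\<lambda>t3. Q (t1 + (1 + (t + t' + 1)) + t3 + 1)) s)
          (r'(32 := q div 2, 30 := code (x @ x)), m)"
          using r' ov by (simp add: wp_Bin numeral_add_Suc add.assoc)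
      qed (use r' len2[OF False] in auto)
      then show ?thesis using False r' by (simp add: wp_simps numeral_add_Suc add.assoc)
    qed
    show ?thesis unfolding power_com_def
    proof (rule wp_While_True)
      show "r 32 \<noteq> 0" using r False by simp
      have "wp W (Some H) (power_body pre) (\<lambda>t1. wp W (Some H) (power_com pre) (\<lambda>t2. Q (t1 + t2 + 1))) (r, m)"
      proof (cases "odd q")
        case True
        then have ov: "length y + length x < 2 ^ W" using len1 nW by simp
        define R where "R = r(35 := q mod 2)"
        have R: "R 30 = code x" "R 31 = length x" "R 33 = code y" "R 34 = length y" "R 35 \<noteq> 0"
          using r True by (auto simp: R_def odd_iff_mod_2_eq_one)
        have "wp W (Some H) (if pre then Call 33 30 33 31 34 else Call 33 33 30 34 31) (\<lambda>t s. wp W (Some H) (Bin Add 34 34 31)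
          (\<lambda>t' s. wp W (Some H) (Seq (Bin Div 32 32 22) (If 32 (Seq (Call 30 30 30 31 31) (Bin Add 31 31 31)) skip))
          (\<lambda>t2. wp W (Some H) (power_com pre) (\<lambda>t3. Q (1 + (t + t' + 1) + t2 + t3 + 1))) s) s) (R, m)"
        proof -
          have *: "wp W (Some H) (Bin Add 34 34 31)
            (\<lambda>t' s. wp W (Some H) (Seq (Bin Div 32 32 22) (If 32 (Seq (Call 30 30 30 31 31) (Bin Add 31 31 31)) skip))
            (\<lambda>t2. wp W (Some H) (power_com pre) (\<lambda>t3. Q (1 + (t + t' + 1) + t2 + t3 + 1))) s) (R(33 := code y'), m)"
            if t: "t \<le> T + 1" for t
          proof -
            have "wp W (Some H) (Seq (Bin Div 32 32 22) (If 32 (Seq (Call 30 30 30 31 31) (Bin Add 31 31 31)) skip))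
              (\<lambda>t2. wp W (Some H) (power_com pre) (\<lambda>t3. Q ((1 + (t + 1 + 1)) + t2 + t3 + 1))) (R(33 := code y', 34 := length y'), m)"
              by (rule tail) (use t r True in \<open>auto simp: R_def acc_def y'_def\<close>)
            moreover have "length y' = length y + length x" using True by (simp add: y'_def)
            ultimately show ?thesis using R ov unfolding wp_Bin by (simp add: add.assoc numeral_add_Suc)
          qed
          show ?thesis
          proof (cases pre)
            case pre: True
            then have pre': "pre = True" by simp
            show ?thesis unfolding pre' if_True
              by (rule wp_combine[of _ _ x _ y]) (use R len1 * True pre in \<open>auto simp: y'_def\<close>)
          next
            case pre: False
            then have pre': "pre = False" by simp
            show ?thesis unfolding pre' if_False
              by (rule wp_combine[of _ _ y _ x]) (use R len1 * True pre in \<open>auto simp: y'_def\<close>)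
          qed
        qed
        then show ?thesis
          unfolding power_body_def wp_Seq[of _ _ "If 35 _ _"] wp_Seq[of _ _ "Bin Mod _ _ _"]
          using R unfolding R_def by (simp add: add.assoc numeral_add_Suc wp_If wp_Bin wp_Move r wp_Seq[of _ _ "if pre then _ else _"])
      next
        case False
        have "wp W (Some H) (Seq (Bin Div 32 32 22) (If 32 (Seq (Call 30 30 30 31 31) (Bin Add 31 31 31)) skip))
              (\<lambda>t2. wp W (Some H) (power_com pre) (\<lambda>t3. Q (3 + t2 + t3 + 1))) (r(35 := 0), m)"
          by (rule tail) (use r False in \<open>auto simp: acc_def y'_def\<close>)
        then show ?thesis
          using False r
          unfolding power_body_def wp_Seq[of _ _ "If 35 _ _"] wp_Seq[of _ _ "Bin Mod _ _ _"]
          by (simp add: add.assoc numeral_add_Suc wp_If wp_Bin wp_Move)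
      qed
      then show "wp W (Some H) (power_body pre) (\<lambda>t1. wp W (Some H) (While 32 (power_body pre)) (\<lambda>t2. Q (t1 + t2 + 1))) (r, m)"
        unfolding power_com_def .
    qed
  qed
qed

end


section \<open>Records in memory and the descent for a prefix\<close>

text \<open>The node in register \<open>v\<close> is read: children to 9 and 10, the exponent of the left child to 11, the
  code and the length of the left child to 30 and 31.\<close>

definition load_node :: "reg \<Rightarrow> com" where
  "load_node v = Seq (Bin Add 8 v 22) (Seq (Load 9 8) (Seq (Bin Add 8 v 23) (Seq (Load 10 8)
    (Seq (Bin Add 8 v 24) (Seq (Load 11 8) (Seq (Load 31 9) (Seq (Bin Add 8 9 21) (Load 30 8))))))))"

definition node_power :: "reg \<Rightarrow> reg \<Rightarrow> bool \<Rightarrow> com" where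
  "node_power v q pre = Seq (Bin Add 8 v 21) (Seq (Load 30 8) (Seq (Load 31 v) (Seq (Move 32 q) (power_com pre))))"

definition full_com :: "bool \<Rightarrow> com" where
  "full_com pre = Seq (node_power 2 21 pre) (Const 5 0)"

text \<open>The remaining prefix, of length in register 5, of the node in register 2.\<close>

definition prefix_body :: com where
  "prefix_body = Seq (Load 6 2) (Seq (Bin Equal 7 6 5) (If 7 (full_com False)
    (Seq (load_node 2) (Seq (Bin Div 32 5 31) (Seq (Bin Less 7 32 11)
    (Seq (If 7 (Move 2 9) (Seq (Move 32 11) (Move 2 10)))
    (Seq (Bin Mul 7 32 31) (Seq (Bin Sub 5 5 7) (power_com False)))))))))"

lemma take_rep:
  assumes "q < c" "e \<le> length x"
  shows "take (q * length x + e) (rep c x @ z) = rep q x @ take e x"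
proof -
  have "rep c x = rep q x @ x @ rep (c - Suc q) x"
    using assms(1) rep_add[of q "Suc (c - Suc q)" x] by simp
  then show ?thesis using assms(2) by simp
qed

text \<open>Division finds where a prefix of a node ends: inside a copy of the left child, or, if
  the quotient reaches the exponent, in the right child behind all copies.\<close>

lemma take_step:
  assumes small_def: "small \<longleftrightarrow> e div length x < c"
    and q_def: "q = (if small then e div length x else c)"
    and u_def: "u = (if small then x else z)"
    and l: "0 < length x" and e: "e \<le> c * length x + length z"
  shows "q * length x \<le> e" "e - q * length x \<le> length u"
    "take e (rep c x @ z) = rep q x @ take (e - q * length x) u"
proof -
  have "q \<le> e div length x" unfolding q_def small_def by auto
  then have "q * length x \<le> e div length x * length x" by (rule mult_le_mono1)
  also have "\<dots> \<le> e" by simp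
  finally show ql: "q * length x \<le> e" .
  then obtain e' where e': "e = q * length x + e'" using le_Suc_ex by blast
  show le: "e - q * length x \<le> length u"
  proof (cases small)
    case True
    then have "e - q * length x = e mod length x" by (simp add: q_def minus_div_mult_eq_mod)
    then show ?thesis using True l by (simp add: u_def less_imp_le)
  next
    case False
    then show ?thesis using e by (simp add: q_def u_def)
  qed
  show "take e (rep c x @ z) = rep q x @ take (e - q * length x) u"
  proof (cases small)
    case True
    have "q < c" using True unfolding q_def by (simp flip: small_def)
    moreover have "u = x" using True by (simp add: u_def)
    moreover have "e' \<le> length x" using le \<open>u = x\<close> unfolding e' by simp
    ultimately show ?thesis unfolding e' by (simp only: take_rep add_diff_cancel_left')
  next
    case False
    then have "q = c" "u = z" by (auto simp: q_def u_def)
    then show ?thesis unfolding e' by simp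
  qed
qed

lemma floor_log_mult:
  assumes "q * l \<le> L" "0 < l" "l \<le> L"
  shows "floor_log q + floor_log l \<le> floor_log L"
proof (cases "q = 0")
  case True
  then show ?thesis using assms(3) by (simp add: floor_log_le_iff)
next
  case False
  then have "2 ^ floor_log q * 2 ^ floor_log l \<le> q * l"
    using assms(2) by (intro mult_le_mono floor_log_exp2_le) auto
  then have "2 ^ (floor_log q + floor_log l) \<le> L" using assms(1) by (simp add: power_add)
  from floor_log_le_iff[OF this] show ?thesis by simp
qed

text \<open>\<open>V\<close> contains the addresses of the records. The bound on \<open>cnt v * slen (right v)\<close> lets
  \<open>floor_log (slen v)\<close> pay for the power of the left child also when the descent goes right.\<close>

locale node_memory = combination W enc n f h H T
  for W :: nat and enc :: "'b \<Rightarrow> nat" and n :: nat and f :: "'a list \<Rightarrow> 'b"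
    and h :: "'b \<Rightarrow> 'b \<Rightarrow> nat \<Rightarrow> nat \<Rightarrow> 'b" and H :: com and T :: nat +
  fixes V :: "nat set" and str :: "nat \<Rightarrow> 'a list" and ht :: "nat \<Rightarrow> nat" and m :: "nat \<Rightarrow> nat"
  assumes node: "v \<in> V \<Longrightarrow> m v = length (str v) \<and> 0 < length (str v) \<and> length (str v) \<le> n \<and>
      m (v + 1) = code (str v) \<and> v + 4 < 2 ^ W"
    and inner: "v \<in> V \<Longrightarrow> length (str v) \<noteq> 1 \<Longrightarrow> m (v + 2) \<in> V \<and> m (v + 3) \<in> V \<and> 0 < m (v + 4) \<and>
      str v = rep (m (v + 4)) (str (m (v + 2))) @ str (m (v + 3)) \<and>
      m (v + 4) * length (str (m (v + 3))) \<le> length (str v) \<and>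
      ht (m (v + 2)) < ht v \<and> ht (m (v + 3)) < ht v"
begin

abbreviation slen :: "nat \<Rightarrow> nat" where "slen v \<equiv> length (str v)"

abbreviation left :: "nat \<Rightarrow> nat" where "left v \<equiv> m (v + 2)"
abbreviation right :: "nat \<Rightarrow> nat" where "right v \<equiv> m (v + 3)"
abbreviation cnt :: "nat \<Rightarrow> nat" where "cnt v \<equiv> m (v + 4)"

definition consts_ok :: "(nat \<Rightarrow> nat) \<Rightarrow> bool" where
  "consts_ok r \<longleftrightarrow> r 21 = 1 \<and> r 22 = 2 \<and> r 23 = 3 \<and> r 24 = 4"

lemma wp_load_node:
  assumes "r v = u" "u \<in> V" "slen u \<noteq> 1" "consts_ok r" "v \<notin> {8, 9, 10, 11}"
    and "\<And>t. t \<le> 9 \<Longrightarrow> Q t (r(8 := left u + 1, 9 := left u, 10 := right u, 11 := cnt u,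
      30 := code (str (left u)), 31 := slen (left u)), m)"
  shows "wp W (Some H) (load_node v) Q (r, m)"
proof -
  have "u + 4 < 2 ^ W" "left u + 4 < 2 ^ W" "m (left u) = slen (left u)" "m (left u + 1) = code (str (left u))"
    using node[OF assms(2)] node[of "left u"] inner[OF assms(2,3)] by auto
  then show ?thesis
    using assms unfolding load_node_def consts_ok_def
    by (simp add: wp_simps numeral_add_Suc fun_upd_twist)
qed

text \<open>A potential for the descents: the loss of height pays for the constant work and the
  power with exponent 1, the loss in the logarithm of the length for the power with exponent
  \<open>q\<close>.\<close>

definition budget :: "nat \<Rightarrow> nat" where
  "budget v = (2 * T + 40) * (2 * ht v + floor_log (slen v) + 1)"

lemma wp_node_power:
  assumes "r v = u" "u \<in> V" "r q = c" "consts_ok r" "acc r y" "length y + c * slen u \<le> n"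
    and "v \<noteq> 8" "v < 30" "q \<noteq> 8" "q < 30"
    and "\<And>t r'. t \<le> (2 * T + 12) * bits c + 5 \<Longrightarrow>
      acc r' (if pre then rep c (str u) @ y else y @ rep c (str u)) \<Longrightarrow>
      (\<And>k. k < 30 \<Longrightarrow> k \<noteq> 8 \<Longrightarrow> r' k = r k) \<Longrightarrow> Q t (r', m)"
  shows "wp W (Some H) (node_power v q pre) Q (r, m)"
proof -
  have c: "r 21 = 1" "r 22 = 2" using assms(4) by (auto simp: consts_ok_def)
  have u: "u + 1 < 2 ^ W" "m (u + 1) = code (str u)" "m u = slen u" using node[OF assms(2)] by auto
  have "wp W (Some H) (power_com pre) (\<lambda>t. Q (4 + t))
    (r(8 := u + 1, 30 := code (str u), 31 := slen u, 32 := c), m)"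
  proof (rule wp_power_com[where q = c and x = "str u" and y = y])
    fix t r'
    assume t: "t \<le> (2 * T + 12) * bits c + 1" and a: "acc r' (if pre then rep c (str u) @ y else y @ rep c (str u))"
      and keep: "\<And>k. k < 30 \<Longrightarrow> r' k = (r(8 := u + 1, 30 := code (str u), 31 := slen u, 32 := c)) k"
    show "Q (4 + t) (r', m)"
      by (rule assms(11)) (use t a keep in \<open>auto simp: acc_def\<close>)
  qed (use assms c in \<open>auto simp: acc_def\<close>)
  then show ?thesis
    unfolding node_power_def using c u assms(1,3,7-10) by (simp add: wp_simps numeral_add_Suc)
qed

lemma wp_full_com:
  assumes "r 2 = v" "v \<in> V" "consts_ok r" "acc r y" "length y + slen v \<le> n"
    and "\<And>t r'. t \<le> 2 * T + 18 \<Longrightarrow> acc r' (if pre then str v @ y else y @ str v) \<Longrightarrow> r' 5 = 0 \<Longrightarrow>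
      (\<And>k. k < 30 \<Longrightarrow> k \<notin> {5, 8} \<Longrightarrow> r' k = r k) \<Longrightarrow> Q t (r', m)"
  shows "wp W (Some H) (full_com pre) Q (r, m)"
  unfolding full_com_def wp_Seq
proof (rule wp_node_power[where u = v and c = 1 and y = y])
  fix t r'
  assume "t \<le> (2 * T + 12) * bits 1 + 5" "acc r' (if pre then rep 1 (str v) @ y else y @ rep 1 (str v))"
    "\<And>k. k < 30 \<Longrightarrow> k \<noteq> 8 \<Longrightarrow> r' k = r k"
  then have "Q (t + 1) (r'(5 := 0), m)"
    by (intro assms(6)) (auto simp: acc_def bits_def)
  then show "wp W (Some H) (Const 5 0) (\<lambda>t2. Q (t + t2)) (r', m)" by (simp add: wp_simps)
qed (use assms in \<open>auto simp: consts_ok_def\<close>)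

text \<open>One step of a descent costs at most two powers, with exponents 1 and \<open>q\<close>.\<close>

lemma budget_child:
  assumes "c * slen u \<le> slen v" "ht u < ht v" "q \<le> c" "u \<in> V" "slen u \<le> slen v"
  shows "(2 * T + 40) * (floor_log q + 2) + budget u \<le> budget v"
proof -
  have "q * slen u \<le> slen v" using assms(1,3) mult_le_mono1 le_trans by blast
  then have "floor_log q + floor_log (slen u) \<le> floor_log (slen v)"
    using floor_log_mult node[OF assms(4)] assms(5) by blast
  then have "floor_log q + 2 + (2 * ht u + floor_log (slen u) + 1) \<le> 2 * ht v + floor_log (slen v) + 1"
    using assms(2) by linarith
  then show ?thesis
    unfolding budget_def add_mult_distrib2[symmetric] by (rule mult_le_mono2)
qed

lemma child_facts:
  assumes "v \<in> V" "slen v \<noteq> 1"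
  shows "left v \<in> V" "right v \<in> V" "0 < cnt v" "ht (left v) < ht v" "ht (right v) < ht v"
    "str v = rep (cnt v) (str (left v)) @ str (right v)"
    "slen v = cnt v * slen (left v) + slen (right v)"
    "cnt v * slen (left v) \<le> slen v" "cnt v * slen (right v) \<le> slen v"
    "slen (left v) \<le> slen v" "slen (right v) \<le> slen v" "0 < slen (left v)" "0 < slen (right v)"
proof -
  note i = inner[OF assms]
  show "left v \<in> V" "right v \<in> V" "0 < cnt v" "ht (left v) < ht v" "ht (right v) < ht v"
    "str v = rep (cnt v) (str (left v)) @ str (right v)" "cnt v * slen (right v) \<le> slen v"
    using i by auto
  then show s: "slen v = cnt v * slen (left v) + slen (right v)"
    by (metis length_append length_concat_replicate)
  then show "cnt v * slen (left v) \<le> slen v" "slen (right v) \<le> slen v" by linarith+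
  have "1 * slen (left v) \<le> cnt v * slen (left v)" using i by (intro mult_le_mono1) simp
  then show "slen (left v) \<le> slen v" using s by linarith
  show "0 < slen (left v)" "0 < slen (right v)" using i node by blast+
qed

lemma wp_prefix_loop:
  assumes "v \<in> V" "r 2 = v" "r 5 = e" "e \<le> slen v" "consts_ok r" "acc r y" "length y + e \<le> n"
    and "\<And>t r'. t \<le> budget v + 1 \<Longrightarrow> acc r' (y @ take e (str v)) \<Longrightarrow> Q t (r', m)"
  shows "wp W (Some H) (While 5 prefix_body) Q (r, m)"
  using assms
proof (induction "ht v" arbitrary: v r e y Q rule: less_induct)
  case less
  note v = less.prems(1)
  have c: "r 21 = 1" "r 22 = 2" "r 23 = 3" "r 24 = 4" using less.prems(5) by (auto simp: consts_ok_def)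
  show ?case
  proof (cases "e = 0")
    case True
    show ?thesis by (rule wp_While_False) (use less.prems True in auto)
  next
    case False
    let ?loop = "While 5 prefix_body"
    let ?P = "\<lambda>t1. wp W (Some H) ?loop (\<lambda>t2. Q (t1 + t2 + 1))"
    have "wp W (Some H) prefix_body ?P (r, m)"
    proof (cases "e = slen v")
      case True
      have "wp W (Some H) (full_com False) (\<lambda>t. ?P (3 + t)) (r(6 := slen v, 7 := 1), m)"
      proof (rule wp_full_com)
        fix t r'
        assume t: "t \<le> 2 * T + 18" and a: "acc r' (if False then str v @ y else y @ str v)" and r': "r' 5 = 0"
        have "Q (3 + t + 1 + 1) (r', m)"
          by (rule less.prems(8)) (use t a True in \<open>auto simp: budget_def\<close>)
        then show "?P (3 + t) (r', m)" by (intro wp_While_False r')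
      qed (use less.prems True in \<open>auto simp: consts_ok_def acc_def\<close>)
      then show ?thesis
        unfolding prefix_body_def using less.prems(2,3) True node[OF v]
        by (simp add: wp_simps numeral_add_Suc)
    next
      case ne: False
      \<comment> \<open>A nonempty proper prefix exists only for length above 1, so the child fields
        of the record are meaningful.\<close>
      then have "slen v \<noteq> 1" using False less.prems(4) by auto
      note ch = child_facts[OF v this]
      let ?l = "slen (left v)"
      define small where "small \<longleftrightarrow> e div ?l < cnt v"
      define q where "q = (if small then e div ?l else cnt v)"
      define u where "u = (if small then left v else right v)"
      define e' where "e' = e - q * ?l"
      have u_str: "str u = (if small then str (left v) else str (right v))" by (simp add: u_def)
      have e_le: "e \<le> cnt v * ?l + slen (right v)" using less.prems(4) ch(7) by simp
      note step = take_step[OF small_def q_def u_str ch(12) e_le, folded e'_def]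
      note ql = step(1) and e'u = step(2)
      have e': "e = q * ?l + e'" using ql by (simp add: e'_def)
      have u: "u \<in> V" "ht u < ht v" "slen u \<le> slen v" "cnt v * slen u \<le> slen v" "q \<le> cnt v"
        using ch unfolding u_def q_def small_def by auto
      have str: "take e (str v) = rep q (str (left v)) @ take e' (str u)"
        using step(3) ch(6) by simp
      have lt: "e < 2 ^ W" "q * ?l < 2 ^ W" using less.prems(7) ql nW by linarith+
      \<comment> \<open>Both branches arrive at the power with the same register contents, after the
        at most 9 steps of \<open>load_node\<close> and 9 or 10 further ones.\<close>
      have pw: "wp W (Some H) (power_com False) (\<lambda>t. ?P (t1 + t)) (R, m)"
        if t1: "t1 \<le> 19" and R: "R 2 = u" "R 5 = e'" "R 30 = code (str (left v))" "R 31 = ?l" "R 32 = q"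
          "consts_ok R" "acc R y" for t1 R
      proof (rule wp_power_com[where q = q and x = "str (left v)" and y = y])
        fix t r'
        assume t: "t \<le> (2 * T + 12) * bits q + 1"
          and a: "acc r' (if False then rep q (str (left v)) @ y else y @ rep q (str (left v)))"
          and keep: "\<And>k. k < 30 \<Longrightarrow> r' k = R k"
        show "?P (t1 + t) (r', m)"
        proof (rule less.hyps[of u _ e' "y @ rep q (str (left v))"])
          fix t2 r2
          assume t2: "t2 \<le> budget u + 1" and a2: "acc r2 ((y @ rep q (str (left v))) @ take e' (str u))"
          have "bits q \<le> floor_log q + 1" using bits_le[of q] by simp
          then have "(2 * T + 12) * bits q \<le> (2 * T + 12) * (floor_log q + 1)" by (rule mult_le_mono2)
          moreover have "(2 * T + 40) * (floor_log q + 2) + budget u \<le> budget v"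
            by (rule budget_child[OF u(4,2,5,1,3)])
          moreover have "(2 * T + 12) * (floor_log q + 1) + 28 \<le> (2 * T + 40) * (floor_log q + 2)"
            by (simp add: algebra_simps)
          ultimately have "t1 + t + t2 + 1 \<le> budget v + 1" using t t1 t2 by linarith
          then show "Q (t1 + t + t2 + 1) (r2, m)"
            by (rule less.prems(8)) (use a2 in \<open>simp add: str\<close>)
        qed (use u e'u a keep R less.prems(7) e' in \<open>auto simp: consts_ok_def\<close>)
      qed (use less.prems R e' in \<open>auto simp: consts_ok_def\<close>)
      have "wp W (Some H) (load_node 2)
        (\<lambda>t. wp W (Some H) (Seq (Bin Div 32 5 31) (Seq (Bin Less 7 32 11)
          (Seq (If 7 (Move 2 9) (Seq (Move 32 11) (Move 2 10)))
          (Seq (Bin Mul 7 32 31) (Seq (Bin Sub 5 5 7) (power_com False)))))) (\<lambda>t'. ?P (3 + (t + t'))))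
        (r(6 := slen v, 7 := 0), m)"
      proof (rule wp_load_node[where u = v])
        fix t :: nat assume t: "t \<le> 9"
        define R where "R = r(6 := slen v, 7 := 0, 8 := left v + 1, 9 := left v, 10 := right v, 11 := cnt v,
          30 := code (str (left v)), 31 := ?l)"
        have R: "R 5 = e" "R 9 = left v" "R 10 = right v" "R 11 = cnt v" "R 30 = code (str (left v))"
          "R 31 = ?l" "consts_ok R" "acc R y"
          using less.prems unfolding R_def consts_ok_def acc_def by auto
        have "wp W (Some H) (Seq (Bin Div 32 5 31) (Seq (Bin Less 7 32 11)
          (Seq (If 7 (Move 2 9) (Seq (Move 32 11) (Move 2 10)))
          (Seq (Bin Mul 7 32 31) (Seq (Bin Sub 5 5 7) (power_com False)))))) (\<lambda>t'. ?P (3 + (t + t'))) (R, m)"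
        proof (cases small)
          case True
          then have sm: "q = e div ?l" "u = left v" "e div ?l < cnt v" by (auto simp: q_def u_def small_def)
          have "wp W (Some H) (power_com False) (\<lambda>t'. ?P (t + 9 + t'))
            (R(32 := q, 7 := 1, 2 := u, 7 := q * ?l, 5 := e'), m)"
            by (rule pw) (use t R in \<open>auto simp: consts_ok_def acc_def\<close>)
          then show ?thesis using sm R lt eval_Sub[OF ql lt(1), unfolded sm(1)]
            by (simp add: wp_simps e'_def numeral_add_Suc add.assoc del: eval_op.simps(2))
        next
          case False
          then have sm: "q = cnt v" "u = right v" "\<not> e div ?l < cnt v" by (auto simp: q_def u_def small_def)
          have "wp W (Some H) (power_com False) (\<lambda>t'. ?P (t + 10 + t'))
            (R(32 := e div ?l, 7 := 0, 32 := q, 2 := u, 7 := q * ?l, 5 := e'), m)"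
            by (rule pw) (use t R in \<open>auto simp: consts_ok_def acc_def\<close>)
          then show ?thesis using sm R lt eval_Sub[OF ql lt(1), unfolded sm(1)]
            by (simp add: wp_simps e'_def numeral_add_Suc add.assoc del: eval_op.simps(2))
        qed
        then show "wp W (Some H) (Seq (Bin Div 32 5 31) (Seq (Bin Less 7 32 11)
          (Seq (If 7 (Move 2 9) (Seq (Move 32 11) (Move 2 10)))
          (Seq (Bin Mul 7 32 31) (Seq (Bin Sub 5 5 7) (power_com False)))))) (\<lambda>t'. ?P (3 + (t + t')))
          (r(6 := slen v, 7 := 0, 8 := left v + 1, 9 := left v, 10 := right v, 11 := cnt v,
          30 := code (str (left v)), 31 := ?l), m)"
          unfolding R_def .
      qed (use less.prems \<open>slen v \<noteq> 1\<close> in \<open>auto simp: consts_ok_def\<close>)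
      then show ?thesis
        unfolding prefix_body_def wp_Seq[of _ _ "Load _ _"] wp_Seq[of _ _ "load_node _"] wp_Seq[of _ _ "Bin Equal _ _ _"] wp_If
        using less.prems(2,3) ne node[OF v]
        by (simp add: wp_Load wp_Bin wp_If wp_Seq[of _ _ "load_node _"] numeral_add_Suc)
    qed
    then show ?thesis by (intro wp_While_True) (use False less.prems in auto)
  qed
qed

end


section \<open>The descent for a suffix\<close>

text \<open>The remaining suffix, of length in register 5, of the node in register 2.\<close>

definition suffix_body :: com where
  "suffix_body = Seq (Load 6 2) (Seq (Bin Equal 7 6 5) (If 7 (full_com True)
    (Seq (load_node 2) (Seq (Load 3 10) (Seq (Bin Less 7 3 5) (If 7
      (Seq (Bin Sub 5 5 3) (Seq (Bin Div 4 5 31) (Seq (Bin Mod 5 5 31) (Seq (node_power 10 21 True)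
        (Seq (node_power 9 4 True) (Move 2 9))))))
      (Move 2 10)))))))"

lemma drop_rep:
  assumes "q < c" "e \<le> length x"
  shows "drop (c * length x - (q * length x + e)) (rep c x) = drop (length x - e) x @ rep q x"
proof -
  obtain d where c: "c = d + (1 + q)" using assms(1) by (metis add.commute less_imp_add_positive add.assoc less_iff_Suc_add plus_1_eq_Suc)
  have "rep c x = rep d x @ x @ rep q x"
    unfolding c rep_add by simp
  moreover have "c * length x - (q * length x + e) = d * length x + (length x - e)"
    using assms(2) unfolding c by (simp add: add_mult_distrib)
  ultimately show ?thesis by simp
qed

context node_memory
begin

text \<open>The suffix is collected from its right end, hence the multiplications from the left.
  Registers 12 to 29 are preserved because the power and the prefix of the split wait there for the
  later phases.\<close>

lemma wp_suffix_loop: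
  assumes "v \<in> V" "r 2 = v" "r 5 = e" "e \<le> slen v" "consts_ok r" "acc r y" "length y + e \<le> n"
    and "\<And>t r'. t \<le> budget v + 1 \<Longrightarrow> acc r' (drop (slen v - e) (str v) @ y) \<Longrightarrow>
      (\<And>k. 12 \<le> k \<Longrightarrow> k < 30 \<Longrightarrow> r' k = r k) \<Longrightarrow> Q t (r', m)"
  shows "wp W (Some H) (While 5 suffix_body) Q (r, m)"
  using assms
proof (induction "ht v" arbitrary: v r e y Q rule: less_induct)
  case less
  note v = less.prems(1)
  have c: "r 21 = 1" "r 22 = 2" "r 23 = 3" "r 24 = 4" using less.prems(5) by (auto simp: consts_ok_def)
  show ?case
  proof (cases "e = 0")
    case True
    show ?thesis by (rule wp_While_False) (use less.prems True in auto)
  next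
    case False
    let ?loop = "While 5 suffix_body"
    let ?P = "\<lambda>t1. wp W (Some H) ?loop (\<lambda>t2. Q (t1 + t2 + 1))"
    have "wp W (Some H) suffix_body ?P (r, m)"
    proof (cases "e = slen v")
      case True
      have "wp W (Some H) (full_com True) (\<lambda>t. ?P (3 + t)) (r(6 := slen v, 7 := 1), m)"
      proof (rule wp_full_com)
        fix t r'
        assume t: "t \<le> 2 * T + 18" and a: "acc r' (if HOL.True then str v @ y else y @ str v)" and r': "r' 5 = 0"
          and keep: "\<And>k. k < 30 \<Longrightarrow> k \<notin> {5, 8} \<Longrightarrow> r' k = (r(6 := slen v, 7 := 1)) k"
        have "Q (3 + t + 1 + 1) (r', m)"
          by (rule less.prems(8)) (use t a True keep in \<open>auto simp: budget_def\<close>)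
        then show "?P (3 + t) (r', m)" by (intro wp_While_False r')
      qed (use less.prems True in \<open>auto simp: consts_ok_def acc_def\<close>)
      then show ?thesis
        unfolding suffix_body_def using less.prems(2,3) True node[OF v]
        by (simp add: wp_simps numeral_add_Suc)
    next
      case ne: False
      then have len1: "slen v \<noteq> 1" using False less.prems(4) by auto
      note ch = child_facts[OF v this]
      let ?l = "slen (left v)" and ?r = "slen (right v)"
      let ?branch = "If 7
        (Seq (Bin Sub 5 5 3) (Seq (Bin Div 4 5 31) (Seq (Bin Mod 5 5 31) (Seq (node_power 10 21 HOL.True)
          (Seq (node_power 9 4 HOL.True) (Move 2 9))))))
        (Move 2 10)"
      have lt: "e < 2 ^ W" using less.prems(7) nW by linarith
      have mr: "m (right v) = ?r" using node[OF ch(2)] by simp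
      have "wp W (Some H) (load_node 2)
        (\<lambda>t. wp W (Some H) (Seq (Load 3 10) (Seq (Bin Less 7 3 5) ?branch)) (\<lambda>t'. ?P (3 + (t + t'))))
        (r(6 := slen v, 7 := 0), m)"
      proof (rule wp_load_node[where u = v])
        fix t :: nat assume t: "t \<le> 9"
        define R where "R = r(6 := slen v, 7 := 0, 8 := left v + 1, 9 := left v, 10 := right v, 11 := cnt v,
          30 := code (str (left v)), 31 := ?l)"
        have R: "R 5 = e" "R 9 = left v" "R 10 = right v" "R 31 = ?l" "consts_ok R" "acc R y"
          "\<And>k. 12 \<le> k \<Longrightarrow> k < 30 \<Longrightarrow> R k = r k"
          using less.prems unfolding R_def consts_ok_def acc_def by auto
        have "wp W (Some H) (Seq (Load 3 10) (Seq (Bin Less 7 3 5) ?branch)) (\<lambda>t'. ?P (3 + (t + t'))) (R, m)"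
        proof (cases "?r < e")
          case False
          have "wp W (Some H) ?loop (\<lambda>t2. Q (t + 7 + t2 + 1)) (R(3 := ?r, 7 := 0, 2 := right v), m)"
          proof (rule less.hyps[of "right v" _ e y])
            fix t2 r'
            assume t2: "t2 \<le> budget (right v) + 1" and a: "acc r' (drop (?r - e) (str (right v)) @ y)"
              and keep: "\<And>k. 12 \<le> k \<Longrightarrow> k < 30 \<Longrightarrow> r' k = (R(3 := ?r, 7 := 0, 2 := right v)) k"
            \<comment> \<open>No power is computed when the suffix lies in the right child; exponent
              0 leaves just the constant part of the bound.\<close>
            have "(2 * T + 40) * (floor_log 0 + 2) + budget (right v) \<le> budget v"
              by (rule budget_child[OF ch(9,5) _ ch(2,11)]) simp
            then have "t + 7 + t2 + 1 \<le> budget v + 1" using t t2 by simp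
            moreover have "drop (slen v - e) (str v) = drop (?r - e) (str (right v))"
              unfolding ch(7) using False by (subst ch(6)) simp
            ultimately show "Q (t + 7 + t2 + 1) (r', m)"
              by (intro less.prems(8)) (use a keep R(7) in auto)
          qed (use ch False R less.prems in \<open>auto simp: consts_ok_def acc_def\<close>)
          then show ?thesis using R mr False by (simp add: wp_simps numeral_add_Suc add.assoc)
        next
          case True
          define e1 where "e1 = e - ?r"
          define q where "q = e1 div ?l"
          define e2 where "e2 = e1 mod ?l"
          have e1: "e1 = q * ?l + e2" by (simp add: q_def e2_def)
          have e2: "e2 < ?l" using ch(12) by (simp add: e2_def)
          \<comment> \<open>Strict because the whole node was treated separately. The cut thus falls
            into one of the copies, with \<open>q < cnt v\<close> whole copies behind it.\<close>
          have "e1 < cnt v * ?l" using True less.prems(4) ne ch(7) by (simp add: e1_def)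
          then have qc: "q < cnt v" unfolding q_def using ch(12) by (simp add: div_less_iff_less_mult)
          have str: "drop (slen v - e) (str v) = drop (?l - e2) (str (left v)) @ rep q (str (left v)) @ str (right v)"
          proof -
            have "slen v - e = cnt v * ?l - (q * ?l + e2)" using True ch(7) e1 unfolding e1_def by linarith
            then have "drop (slen v - e) (str v) = drop (cnt v * ?l - (q * ?l + e2)) (rep (cnt v) (str (left v))) @ str (right v)"
              by (subst ch(6)) simp
            then show ?thesis using drop_rep[OF qc less_imp_le[OF e2]] by simp
          qed
          have ely: "length y + ?r + q * ?l + e2 \<le> n" using less.prems(7) True e1 unfolding e1_def by linarith
          define R1 where "R1 = R(3 := ?r, 7 := 1, 5 := e2, 4 := q)"
          have R1: "R1 5 = e2" "R1 4 = q" "R1 9 = left v" "R1 10 = right v" "consts_ok R1" "acc R1 y" "R1 21 = 1"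
            "\<And>k. 12 \<le> k \<Longrightarrow> k < 30 \<Longrightarrow> R1 k = r k"
            using R unfolding R1_def consts_ok_def acc_def by auto
          have "wp W (Some H) (node_power 10 21 HOL.True) (\<lambda>t1. wp W (Some H) (node_power 9 4 HOL.True)
            (\<lambda>t2. wp W (Some H) (Move 2 9) (\<lambda>t3. ?P (t + 9 + t1 + t2 + t3)))) (R1, m)"
          proof (rule wp_node_power[where u = "right v" and c = 1 and y = y])
            fix t1 R2
            assume t1: "t1 \<le> (2 * T + 12) * bits 1 + 5"
              and a2: "acc R2 (if HOL.True then rep 1 (str (right v)) @ y else y @ rep 1 (str (right v)))"
              and keep2: "\<And>k. k < 30 \<Longrightarrow> k \<noteq> 8 \<Longrightarrow> R2 k = R1 k"
            show "wp W (Some H) (node_power 9 4 HOL.True)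
              (\<lambda>t2. wp W (Some H) (Move 2 9) (\<lambda>t3. ?P (t + 9 + t1 + t2 + t3))) (R2, m)"
            proof (rule wp_node_power[where u = "left v" and c = q and y = "str (right v) @ y"])
              fix t2 R3
              assume t2: "t2 \<le> (2 * T + 12) * bits q + 5"
                and a3: "acc R3 (if HOL.True then rep q (str (left v)) @ str (right v) @ y
                  else (str (right v) @ y) @ rep q (str (left v)))"
                and keep3: "\<And>k. k < 30 \<Longrightarrow> k \<noteq> 8 \<Longrightarrow> R3 k = R2 k"
              have R3: "R3 5 = e2" "R3 9 = left v" "consts_ok R3" "\<And>k. 12 \<le> k \<Longrightarrow> k < 30 \<Longrightarrow> R3 k = r k"
                using keep3 keep2 R1 by (auto simp: consts_ok_def)
              have "wp W (Some H) ?loop (\<lambda>t4. Q (t + 9 + t1 + t2 + 1 + t4 + 1)) (R3(2 := left v), m)"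
              proof (rule less.hyps[of "left v" _ e2 "rep q (str (left v)) @ str (right v) @ y"])
                fix t4 r'
                assume t4: "t4 \<le> budget (left v) + 1"
                  and a: "acc r' (drop (?l - e2) (str (left v)) @ rep q (str (left v)) @ str (right v) @ y)"
                  and keep: "\<And>k. 12 \<le> k \<Longrightarrow> k < 30 \<Longrightarrow> r' k = (R3(2 := left v)) k"
                have "bits q \<le> floor_log q + 1" using bits_le[of q] by simp
                then have "(2 * T + 12) * bits q \<le> (2 * T + 12) * (floor_log q + 1)" by (rule mult_le_mono2)
                moreover have "(2 * T + 40) * (floor_log q + 2) + budget (left v) \<le> budget v"
                  by (rule budget_child[OF ch(8,4) _ ch(1,10)]) (use qc in simp)
                moreover have "(2 * T + 12) * (floor_log q + 1) + (2 * T + 12) + 40 \<le> (2 * T + 40) * (floor_log q + 2)"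
                  by (simp add: algebra_simps)
                moreover have "bits 1 = 1" by (simp add: bits_def)
                ultimately have "t + 9 + t1 + t2 + 1 + t4 + 1 \<le> budget v + 1"
                  using t t1 t2 t4 by simp
                then show "Q (t + 9 + t1 + t2 + 1 + t4 + 1) (r', m)"
                  by (rule less.prems(8)) (use a keep R3(4) in \<open>auto simp: str\<close>)
              qed (use ch e2 ely R3 a3 in \<open>auto simp: consts_ok_def acc_def\<close>)
              then show "wp W (Some H) (Move 2 9) (\<lambda>t3. ?P (t + 9 + t1 + t2 + t3)) (R3, m)"
                using R3(2) by (simp add: wp_simps)
            qed (use ch keep2 R1 a2 ely in \<open>auto simp: consts_ok_def\<close>)
          qed (use ch R1 ely in auto)
          moreover have "eval_op W Sub e ?r = e1" unfolding e1_def by (rule eval_Sub) (use True lt in auto)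
          ultimately show ?thesis
            using R mr True unfolding R1_def q_def e2_def
            by (simp add: wp_simps numeral_add_Suc add.assoc fun_upd_twist[of 4 5] del: eval_op.simps(2))
        qed
        then show "wp W (Some H) (Seq (Load 3 10) (Seq (Bin Less 7 3 5) ?branch)) (\<lambda>t'. ?P (3 + (t + t')))
          (r(6 := slen v, 7 := 0, 8 := left v + 1, 9 := left v, 10 := right v, 11 := cnt v,
          30 := code (str (left v)), 31 := ?l), m)"
          unfolding R_def .
      qed (use less.prems len1 in \<open>auto simp: consts_ok_def\<close>)
      then show ?thesis
        unfolding suffix_body_def wp_Seq[of _ _ "Load 6 _"] wp_Seq[of _ _ "Bin Equal _ _ _"]
        using less.prems(2,3) ne node[OF v]
        by (simp add: wp_Load wp_Bin wp_If wp_Seq[of _ _ "load_node _"] numeral_add_Suc)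
    qed
    then show ?thesis by (intro wp_While_True) (use False less.prems in auto)
  qed
qed

end


section \<open>Locating the split of the query range\<close>

text \<open>The query range in the node in register 19 starts at the offset in register 3 and ends at the one
  in 26 (exclusive). On exit it is the suffix, of length in 17, of the node in 12, followed by the power
  of that node with exponent in 18 and by the prefix, of length in 26, of the node in 19. Register 15 is
  the loop flag: before a split it equals register 3, since a range at offset 0 is already a prefix.\<close>

definition split_com :: com where
  "split_com = Seq (Move 12 9) (Seq (Bin Sub 17 31 3) (Seq (Bin Sub 26 26 31) (Seq (Bin Sub 11 11 16)
    (Seq (Bin Sub 11 11 21) (Seq (Bin Div 18 26 31) (Seq (Bin Less 7 18 11)
    (Seq (If 7 (Move 19 9) (Seq (Move 18 11) (Move 19 10)))
    (Seq (Bin Mul 7 18 31) (Seq (Bin Sub 26 26 7) (Const 15 0))))))))))"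

definition child_com :: com where
  "child_com = Seq (Bin Div 16 3 31) (Seq (Bin Less 7 16 11)
    (Seq (If 7 (Move 14 9) (Seq (Move 16 11) (Move 14 10)))
    (Seq (Bin Mul 7 16 31) (Seq (Bin Sub 3 3 7) (Seq (Bin Sub 26 26 7) (Seq (Load 6 14) (Bin Less 7 6 26)))))))"

definition range_body :: com where
  "range_body = Seq (load_node 19) (Seq child_com (If 7 split_com (Seq (Move 19 14) (Move 15 3))))"

context node_memory
begin

definition split_ok :: "'a list \<Rightarrow> (nat \<Rightarrow> nat) \<Rightarrow> bool" where
  "split_ok x r \<longleftrightarrow> r 12 \<in> V \<and> r 19 \<in> V \<and> r 17 \<le> slen (r 12) \<and> r 26 \<le> slen (r 19) \<and>
     x = drop (slen (r 12) - r 17) (str (r 12)) @ rep (r 18) (str (r 12)) @ take (r 26) (str (r 19))"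

text \<open>\<open>z\<close> is the node without the \<open>p\<close> copies skipped before the
  range, and \<open>c\<close> counts the copies after the one in which the range starts. The range
  leaves that copy, so it consists of a suffix of \<open>x\<close>, some of the \<open>c\<close>
  copies, and a prefix of the next copy or of \<open>y\<close>.\<close>

lemma wp_split_com:
  assumes z: "z = x @ rep c x @ y" and s: "s < length x" and e: "length x < e" "e \<le> length z"
    and r: "r 9 = a" "r 10 = b" "a \<in> V" "b \<in> V" "str a = x" "str b = y" "r 31 = length x"
      "r 3 = s" "r 26 = e" "r 21 = 1" "r 11 = p + 1 + c" "r 16 = p"
    and bounds: "length z < 2 ^ W" "p + 1 + c < 2 ^ W"
    and Q: "\<And>t r'. t \<le> 14 \<Longrightarrow> split_ok (drop s (take e z)) r' \<Longrightarrow> r' 15 = 0 \<Longrightarrow>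
      (\<And>k. k \<in> {21, 22, 23, 24, 33, 34} \<Longrightarrow> r' k = r k) \<Longrightarrow> Q t (r', m)"
  shows "wp W (Some H) split_com Q (r, m)"
proof -
  define e2 where "e2 = e - length x"
  define small where "small \<longleftrightarrow> e2 div length x < c"
  define q where "q = (if small then e2 div length x else c)"
  define u where "u = (if small then a else b)"
  have u_str: "str u = (if small then x else y)" using r by (simp add: u_def)
  have xp: "0 < length x" using s by linarith
  have e2_le: "e2 \<le> c * length x + length y" using e z unfolding e2_def by simp
  note step = take_step[OF small_def q_def u_str xp e2_le]
  have sub: "drop s (take e z) = drop s x @ rep q x @ take (e2 - q * length x) (str u)"
  proof -
    have "take e z = x @ take e2 (rep c x @ y)" using e unfolding z e2_def by simp
    then show ?thesis using s step(3) by simp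
  qed
  have ev: "eval_op W Sub (length x) s = length x - s" "eval_op W Sub e (length x) = e2"
    "eval_op W Sub (Suc (p + c)) p = Suc c" "eval_op W Sub (Suc c) (Suc 0) = c"
    "eval_op W Sub e2 (q * length x) = e2 - q * length x" "q * length x < 2 ^ W"
  proof -
    have "length x < 2 ^ W" "e < 2 ^ W" "e2 < 2 ^ W"
      using e bounds unfolding e2_def by linarith+
    then show "eval_op W Sub (length x) s = length x - s" "eval_op W Sub e (length x) = e2"
      "eval_op W Sub e2 (q * length x) = e2 - q * length x" "q * length x < 2 ^ W"
      using s e step(1) by (auto simp: eval_Sub e2_def simp del: eval_op.simps(2))
    show "eval_op W Sub (Suc (p + c)) p = Suc c" "eval_op W Sub (Suc c) (Suc 0) = c"
      using bounds(2) eval_Sub[of p "Suc (p + c)" W] eval_Sub[of "Suc 0" "Suc c" W]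
      by (simp_all del: eval_op.simps(2))
  qed
  define R where "R = r(12 := a, 17 := length x - s, 26 := e2, 11 := c, 18 := e2 div length x)"
  have fin: "Q t (R(7 := i, 18 := q, 19 := u, 7 := q * length x, 26 := e2 - q * length x, 15 := 0), m)"
    if "t \<le> 14" for t i
    by (rule Q) (use that r s step(2) in \<open>auto simp: R_def split_ok_def sub u_def\<close>)
  show ?thesis
  proof (cases small)
    case True
    then have "q = e2 div length x" "u = a" by (auto simp: q_def u_def)
    then show ?thesis
      using fin[of "Suc (Suc (Suc (Suc (Suc (Suc (Suc (Suc (Suc (Suc (Suc (Suc (0))))))))))))" 1] True r ev unfolding split_com_def R_def
      by (simp add: wp_simps small_def del: eval_op.simps(2))
  next
    case False
    then have "q = c" "u = b" by (auto simp: q_def u_def)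
    then show ?thesis
      using fin[of "Suc (Suc (Suc (Suc (Suc (Suc (Suc (Suc (Suc (Suc (Suc (Suc (Suc (0)))))))))))))" 0] False r ev unfolding split_com_def R_def
      by (simp add: wp_simps small_def del: eval_op.simps(2))
  qed
qed

text \<open>Selects the child in which the range starts and makes both offsets relative to it.
  Register 7 tells whether the range extends beyond this child.\<close>

lemma wp_child_com:
  assumes v: "v \<in> V" "slen v \<noteq> 1" and se: "s < e" "e \<le> slen v"
    and r: "r 9 = left v" "r 10 = right v" "r 11 = cnt v" "r 31 = slen (left v)" "r 3 = s" "r 26 = e"
    and Q: "\<And>t p u r'. t \<le> 10 \<Longrightarrow> p * slen (left v) \<le> s \<Longrightarrow> u \<in> V \<Longrightarrow>
      p < cnt v \<and> u = left v \<and> s - p * slen (left v) < slen u \<or> p = cnt v \<and> u = right v \<Longrightarrow>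
      r' 14 = u \<Longrightarrow> r' 3 = s - p * slen (left v) \<Longrightarrow> r' 26 = e - p * slen (left v) \<Longrightarrow> r' 16 = p \<Longrightarrow>
      r' 7 = (if slen u < e - p * slen (left v) then 1 else 0) \<Longrightarrow>
      (\<And>k. k \<notin> {3, 6, 7, 14, 16, 26} \<Longrightarrow> r' k = r k) \<Longrightarrow> Q t (r', m)"
  shows "wp W (Some H) child_com Q (r, m)"
proof -
  note ch = child_facts[OF v]
  let ?l = "slen (left v)"
  define small where "small \<longleftrightarrow> s div ?l < cnt v"
  define p where "p = (if small then s div ?l else cnt v)"
  define u where "u = (if small then left v else right v)"
  have u_str: "str u = (if small then str (left v) else str (right v))" by (simp add: u_def)
  have "s \<le> cnt v * ?l + slen (right v)" using se ch(7) by simp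
  note step = take_step[OF small_def p_def u_str ch(12) this]
  have u: "u \<in> V" "m u = slen u" using ch node unfolding u_def by auto
  have or: "p < cnt v \<and> u = left v \<and> s - p * ?l < slen u \<or> p = cnt v \<and> u = right v"
  proof (cases small)
    case True
    then have "s - p * ?l = s mod ?l" by (simp add: p_def minus_div_mult_eq_mod)
    moreover have "s mod ?l < ?l" using ch(12) by (rule mod_less_divisor)
    moreover have "p < cnt v" using True small_def by (simp add: p_def)
    moreover have "u = left v" using True by (simp add: u_def)
    ultimately show ?thesis by simp
  qed (simp add: p_def u_def)
  have "slen v < 2 ^ W" using node[OF v(1)] nW by linarith
  then have lt: "s < 2 ^ W" "e < 2 ^ W" "p * ?l < 2 ^ W" "p * ?l \<le> e" using se step(1) by linarith+
  note ev = eval_Sub[OF step(1) lt(1)] eval_Sub[OF lt(4,2)] lt(3)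
  define b where "b = (if slen u < e - p * ?l then 1 else 0 :: nat)"
  have fin: "Q t (r(16 := s div ?l, 7 := i, 16 := p, 14 := u, 7 := p * ?l, 3 := s - p * ?l, 26 := e - p * ?l,
      6 := slen u, 7 := b), m)" if "t \<le> 10" for t i
    by (rule Q[OF that step(1) u(1) or]) (auto simp: b_def)
  show ?thesis
  proof (cases small)
    case True
    then have pu: "p = s div ?l" "u = left v" by (auto simp: p_def u_def)
    show ?thesis
      using fin[of "Suc (Suc (Suc (Suc (Suc (Suc (Suc (Suc (Suc 0))))))))" 1] True r ev u(2)
      unfolding child_com_def pu b_def
      by (simp add: wp_simps small_def split: if_splits del: eval_op.simps(2))
  next
    case False
    then have pu: "p = cnt v" "u = right v" by (auto simp: p_def u_def)
    show ?thesis
      using fin[of "Suc (Suc (Suc (Suc (Suc (Suc (Suc (Suc (Suc (Suc 0)))))))))" 0] False r ev u(2)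
      unfolding child_com_def pu b_def
      by (simp add: wp_simps small_def split: if_splits del: eval_op.simps(2))
  qed
qed

text \<open>Registers 17 and 18 stay 0, and register 12 stays a valid node, until a split. If offset
  0 is reached instead, the result has an empty suffix and an empty power, so both exits have the
  form \<open>split_ok\<close>. No call occurs, so the cost per level is a constant.\<close>

lemma wp_range_loop:
  assumes "v \<in> V" "r 19 = v" "r 3 = s" "r 26 = e" "r 15 = s" "s < e" "e \<le> slen v" "consts_ok r"
    and "r 12 \<in> V" "r 17 = 0" "r 18 = 0"
    and "\<And>t r'. t \<le> 40 * (ht v + 1) + 1 \<Longrightarrow> split_ok (drop s (take e (str v))) r' \<Longrightarrow>
      (\<And>k. k \<in> {21, 22, 23, 24, 33, 34} \<Longrightarrow> r' k = r k) \<Longrightarrow> Q t (r', m)"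
  shows "wp W (Some H) (While 15 range_body) Q (r, m)"
  using assms
proof (induction "ht v" arbitrary: v r s e Q rule: less_induct)
  case less
  note v = less.prems(1)
  show ?case
  proof (cases "s = 0")
    case True
    show ?thesis
      by (rule wp_While_False) (use less.prems True in \<open>auto simp: split_ok_def\<close>)
  next
    case False
    then have len1: "slen v \<noteq> 1" using less.prems(6,7) by linarith
    note ch = child_facts[OF v len1]
    let ?l = "slen (left v)"
    let ?loop = "While 15 range_body"
    let ?P = "\<lambda>t1. wp W (Some H) ?loop (\<lambda>t2. Q (t1 + t2 + 1))"
    have "wp W (Some H) (load_node 19) (\<lambda>t1. wp W (Some H) child_com
      (\<lambda>t2. wp W (Some H) (If 7 split_com (Seq (Move 19 14) (Move 15 3))) (\<lambda>t3. ?P (t1 + (t2 + t3))))) (r, m)"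
    proof (rule wp_load_node[where u = v])
      fix t1 :: nat assume t1: "t1 \<le> 9"
      define R where "R = r(8 := left v + 1, 9 := left v, 10 := right v, 11 := cnt v,
          30 := code (str (left v)), 31 := ?l)"
      have R: "R 9 = left v" "R 10 = right v" "R 11 = cnt v" "R 31 = ?l" "R 3 = s" "R 26 = e"
        "R 12 \<in> V" "R 17 = 0" "R 18 = 0" "\<And>k. k \<in> {21, 22, 23, 24, 33, 34} \<Longrightarrow> R k = r k"
        using less.prems unfolding R_def by auto
      have "wp W (Some H) child_com
        (\<lambda>t2. wp W (Some H) (If 7 split_com (Seq (Move 19 14) (Move 15 3))) (\<lambda>t3. ?P (t1 + (t2 + t3)))) (R, m)"
      proof (rule wp_child_com[OF v len1 less.prems(6,7) R(1-6)])
        fix t2 p u :: nat and r' :: "nat \<Rightarrow> nat"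
        assume t2: "t2 \<le> 10" and ps: "p * ?l \<le> s" and u: "u \<in> V"
          and pu: "p < cnt v \<and> u = left v \<and> s - p * ?l < slen u \<or> p = cnt v \<and> u = right v"
          and r': "r' 14 = u" "r' 3 = s - p * ?l" "r' 26 = e - p * ?l" "r' 16 = p"
            "r' 7 = (if slen u < e - p * ?l then 1 else 0)"
          and keep: "\<And>k. k \<notin> {3, 6, 7, 14, 16, 26} \<Longrightarrow> r' k = R k"
        have htu: "ht u < ht v" using pu ch by auto
        have R': "r' k = r k" if "k \<in> {21, 22, 23, 24, 33, 34}" for k
          using keep[of k] R(10)[OF that] that by auto
        show "wp W (Some H) (If 7 split_com (Seq (Move 19 14) (Move 15 3))) (\<lambda>t3. ?P (t1 + (t2 + t3))) (r', m)"
        proof (cases "slen u < e - p * ?l")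
          case True
          \<comment> \<open>A range that starts in the right child also ends there, so it can be
            split only at a copy of the left child.\<close>
          have pl: "p < cnt v" "u = left v" "s - p * ?l < ?l"
            using pu True less.prems(7) ch(7) by auto
          obtain c where c: "cnt v = p + 1 + c" using pl(1) less_iff_Suc_add by auto
          define z where "z = str (left v) @ rep c (str (left v)) @ str (right v)"
          have vz: "str v = rep p (str (left v)) @ z"
            using ch(6) unfolding c z_def rep_add by simp
          then have sub: "drop s (take e (str v)) = drop (s - p * ?l) (take (e - p * ?l) z)"
            using ps less.prems(6) by simp
          have "slen v = p * ?l + length z" using vz by simp
          then have lz: "e - p * ?l \<le> length z" "length z < 2 ^ W"
            using less.prems(7) node[OF v] nW by linarith+
          have "cnt v * 1 \<le> cnt v * ?l" using ch(12) by (intro mult_le_mono2) (simp only: One_nat_def Suc_le_eq)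
          then have "cnt v \<le> slen v" using ch(8) by linarith
          then have "cnt v < 2 ^ W" using node[OF v] nW by linarith
          then have cW: "p + 1 + c < 2 ^ W" by (simp add: c)
          have rr: "r' 9 = left v" "r' 10 = right v" "r' 31 = ?l" "r' 11 = p + 1 + c" "r' 21 = 1"
            using keep[of 9] keep[of 10] keep[of 31] keep[of 11] R(1-4) R'[of 21] c less.prems(8)
            by (simp_all add: consts_ok_def)
          have "wp W (Some H) split_com (\<lambda>t3. ?P (t1 + (t2 + (t3 + 1)))) (r', m)"
          proof (rule wp_split_com[where a = "left v" and b = "right v" and p = p, OF z_def pl(3) True[unfolded pl(2)] lz(1)])
            fix t3 :: nat and r'' :: "nat \<Rightarrow> nat"
            assume t3: "t3 \<le> 14" and sp: "split_ok (drop (s - p * ?l) (take (e - p * ?l) z)) r''"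
              and r15: "r'' 15 = 0" and keep2: "\<And>k. k \<in> {21, 22, 23, 24, 33, 34} \<Longrightarrow> r'' k = r' k"
            show "?P (t1 + (t2 + (t3 + 1))) (r'', m)"
            proof (rule wp_While_False)
              show "r'' 15 = 0" by (rule r15)
              show "Q (t1 + (t2 + (t3 + 1)) + 1 + 1) (r'', m)"
                by (rule less.prems(12)) (use t1 t2 t3 sp keep2 R' sub in auto)
            qed
          qed (fact rr r' ch(1,2) lz(2) cW refl)+
          then show ?thesis using r'(5) True by (simp add: wp_If)
        next
          case False
          have sub: "drop s (take e (str v)) = drop (s - p * ?l) (take (e - p * ?l) (str u))"
            using pu
          proof
            assume a: "p < cnt v \<and> u = left v \<and> s - p * ?l < slen u"
            then obtain c where c: "cnt v = p + (1 + c)" using less_iff_Suc_add[of p] by auto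
            have "str v = rep p (str (left v)) @ str u @ rep c (str (left v)) @ str (right v)"
              using ch(6) a unfolding c rep_add by simp
            then show ?thesis using False ps less.prems(6) by simp
          next
            assume "p = cnt v \<and> u = right v"
            then show ?thesis using ch(6) ps less.prems(6) by (subst ch(6)) simp
          qed
          have "wp W (Some H) ?loop (\<lambda>t4. Q (t1 + (t2 + 3) + t4 + 1)) (r'(19 := u, 15 := s - p * ?l), m)"
          proof (rule less.hyps[of u])
            show "s - p * ?l < e - p * ?l" using ps less.prems(6) by linarith
            fix t4 :: nat and r'' :: "nat \<Rightarrow> nat"
            assume t4: "t4 \<le> 40 * (ht u + 1) + 1" and sp: "split_ok (drop (s - p * ?l) (take (e - p * ?l) (str u))) r''"
              and keep2: "\<And>k. k \<in> {21, 22, 23, 24, 33, 34} \<Longrightarrow> r'' k = (r'(19 := u, 15 := s - p * ?l)) k"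
            show "Q (t1 + (t2 + 3) + t4 + 1) (r'', m)"
            proof (rule less.prems(12))
              show "t1 + (t2 + 3) + t4 + 1 \<le> 40 * (ht v + 1) + 1"
              proof -
                have "ht u + 1 \<le> ht v" using htu by simp
                then have "40 * (ht u + 1) \<le> 40 * ht v" by (rule mult_le_mono2)
                then show ?thesis using t1 t2 t4 by simp
              qed
              show "split_ok (drop s (take e (str v))) r''" unfolding sub by (rule sp)
              show "r'' k = r k" if k: "k \<in> {21, 22, 23, 24, 33, 34}" for k
                using keep2[OF k] R'[OF k] k by auto
            qed
          next
            show "consts_ok (r'(19 := u, 15 := s - p * ?l))"
              using R'[of 21] R'[of 22] R'[of 23] R'[of 24] less.prems(8) by (simp add: consts_ok_def)
          qed (use htu u r' False keep[of 12] keep[of 17] keep[of 18] R(7-9) in simp_all)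
          then show ?thesis using r' False by (simp add: wp_simps numeral_add_Suc add.assoc)
        qed
      qed
      then show "wp W (Some H) child_com
        (\<lambda>t2. wp W (Some H) (If 7 split_com (Seq (Move 19 14) (Move 15 3))) (\<lambda>t3. ?P (t1 + (t2 + t3))))
        (r(8 := left v + 1, 9 := left v, 10 := right v, 11 := cnt v,
          30 := code (str (left v)), 31 := ?l), m)"
        unfolding R_def .
    qed (use less.prems len1 in auto)
    then have "wp W (Some H) range_body ?P (r, m)" unfolding range_body_def wp_Seq .
    then show ?thesis by (intro wp_While_True) (use False less.prems in auto)
  qed
qed

end


section \<open>The complete query\<close>

definition init_com :: com where
  "init_com = Seq (Const 21 1) (Seq (Const 22 2) (Seq (Const 23 3) (Seq (Const 24 4)
    (Seq (Bin Sub 3 0 21) (Seq (Move 26 1) (Seq (Move 15 3) (Seq (Const 25 0) (Seq (Load 19 25)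
    (Seq (Load 33 21) (Move 12 19))))))))))"

text \<open>Memory begins with two header words, the address of the root and the code of the empty
  string. The latter initializes the accumulator, whose length register 34 is 0 from the start.
  Register 12 is preset to the root, a valid node in case no split occurs.\<close>

definition query_com :: com where
  "query_com = Seq init_com (Seq (While 15 range_body) (Seq (Seq (Move 2 12) (Move 5 17))
    (Seq (While 5 suffix_body) (Seq (node_power 12 18 False) (Seq (Seq (Move 2 19) (Move 5 26))
    (Seq (While 5 prefix_body) (Move 0 33)))))))"

context node_memory
begin

lemma wp_query_com:
  assumes root: "m 0 \<in> V" "str (m 0) = w" "m 1 = code []"
    and height: "\<And>v. v \<in> V \<Longrightarrow> ht v \<le> d"
    and ij: "1 \<le> i" "i \<le> j" "j \<le> length w" and W: "4 < (2::nat) ^ W"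
  shows "wp W (Some H) query_com (\<lambda>t s. t \<le> 7 * ((2 * T + 40) * (2 * d + floor_log n + 1)) \<and> fst s 0 = code (substring w i j))
    (cells [i, j], m)"
proof -
  define s where "s = i - 1"
  define B where "B = (2 * T + 40) * (2 * d + floor_log n + 1)"
  have x: "substring w i j = drop s (take j w)"
    using ij by (simp add: substring_def s_def drop_take Suc_diff_le)
  have w: "length w \<le> n" "0 < length w" using node[OF root(1)] root(2) by auto
  have budget: "budget v \<le> B" if "v \<in> V" for v
    unfolding budget_def B_def
    using height[OF that] node[OF that] by (intro mult_le_mono add_mono floor_log_le_iff) auto
  have B: "(2 * T + 40) * (floor_log n + 1) \<le> B" "40 * (d + 1) \<le> B" "40 \<le> B"
    unfolding B_def by (simp_all add: algebra_simps)
  let ?Q = "\<lambda>t s. t \<le> 7 * B \<and> fst s 0 = code (substring w i j)"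
  define r0 where "r0 = (cells [i, j])(21 := 1, 22 := 2, 23 := 3, 24 := 4, 3 := s, 26 := j, 15 := s,
    25 := 0, 19 := m 0, 33 := code [], 12 := m 0)"
  have cells: "cells [i, j] 0 = i" "cells [i, j] (Suc 0) = j" "\<And>k. 2 \<le> k \<Longrightarrow> cells [i, j] k = 0"
    by (auto simp: cells_def)
  have r0: "r0 3 = s" "r0 26 = j" "r0 15 = s" "r0 19 = m 0" "r0 33 = code []" "r0 12 = m 0" "r0 34 = 0"
    "r0 17 = 0" "r0 18 = 0" "consts_ok r0"
    unfolding r0_def consts_ok_def by (simp_all add: cells)
  have main: "wp W (Some H) (While 15 range_body) (\<lambda>t1. wp W (Some H) (Seq (Move 2 12) (Move 5 17))
    (\<lambda>t2. wp W (Some H) (While 5 suffix_body) (\<lambda>t3. wp W (Some H) (node_power 12 18 False)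
    (\<lambda>t4. wp W (Some H) (Seq (Move 2 19) (Move 5 26)) (\<lambda>t5. wp W (Some H) (While 5 prefix_body)
    (\<lambda>t6. wp W (Some H) (Move 0 33) (\<lambda>t7. ?Q (11 + (t1 + (t2 + (t3 + (t4 + (t5 + (t6 + t7))))))))))))))  (r0, m)"
  proof (rule wp_range_loop[OF root(1) r0(4,1,2,3)])
    show "s < j" using ij by (simp add: s_def)
    show "j \<le> slen (m 0)" using ij root by simp
    fix t1 r1
    assume t1: "t1 \<le> 40 * (ht (m 0) + 1) + 1" and sp: "split_ok (drop s (take j (str (m 0)))) r1"
      and k1: "\<And>k. k \<in> {21, 22, 23, 24, 33, 34} \<Longrightarrow> r1 k = r0 k"
    define l a q u e where "l = r1 12" and "a = r1 17" and "q = r1 18" and "u = r1 19" and "e = r1 26"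
    have V: "l \<in> V" "u \<in> V" "a \<le> slen l" "e \<le> slen u"
      and eq: "substring w i j = drop (slen l - a) (str l) @ rep q (str l) @ take e (str u)"
      using sp root(2) unfolding split_ok_def x l_def a_def q_def u_def e_def by auto
    have "length (substring w i j) \<le> n" using w by (simp add: x)
    then have len: "a + q * slen l + e \<le> n" using V unfolding eq by simp
    have t1': "t1 \<le> B + 1"
    proof -
      have "40 * (ht (m 0) + 1) \<le> 40 * (d + 1)" using height[OF root(1)] by simp
      then show ?thesis using t1 B by linarith
    qed
    have q: "bits q \<le> floor_log n + 1"
    proof -
      have "q * 1 \<le> q * slen l" using node[OF V(1)] by (intro mult_le_mono2) linarith
      then have "floor_log q \<le> floor_log n" using len by (intro floor_log_le_iff) linarith
      then show ?thesis using bits_le[of q] by linarith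
    qed
    have r1: "consts_ok r1" "acc r1 []" using r0 k1 by (simp_all add: consts_ok_def acc_def)
    have "wp W (Some H) (While 5 suffix_body) (\<lambda>t3. wp W (Some H) (node_power 12 18 False)
      (\<lambda>t4. wp W (Some H) (Seq (Move 2 19) (Move 5 26)) (\<lambda>t5. wp W (Some H) (While 5 prefix_body)
      (\<lambda>t6. wp W (Some H) (Move 0 33) (\<lambda>t7. ?Q (11 + (t1 + ((1 + 1) + (t3 + (t4 + (t5 + (t6 + t7)))))))))))) (r1(2 := l, 5 := a), m)"
    proof (rule wp_suffix_loop[OF V(1) _ _ V(3)])
      show "consts_ok (r1(2 := l, 5 := a))" "acc (r1(2 := l, 5 := a)) []"
        using r1 by (simp_all add: consts_ok_def acc_def)
      show "length ([] :: 'a list) + a \<le> n" using len by simp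
      fix t3 r2
      assume t3: "t3 \<le> budget l + 1" and a2: "acc r2 (drop (slen l - a) (str l) @ [])"
        and k2: "\<And>k. 12 \<le> k \<Longrightarrow> k < 30 \<Longrightarrow> r2 k = (r1(2 := l, 5 := a)) k"
      let ?y = "drop (slen l - a) (str l)"
      have c2: "consts_ok r2" using k2 r1 by (simp add: consts_ok_def)
      show "wp W (Some H) (node_power 12 18 False)
        (\<lambda>t4. wp W (Some H) (Seq (Move 2 19) (Move 5 26)) (\<lambda>t5. wp W (Some H) (While 5 prefix_body)
        (\<lambda>t6. wp W (Some H) (Move 0 33) (\<lambda>t7. ?Q (11 + (t1 + ((1 + 1) + (t3 + (t4 + (t5 + (t6 + t7)))))))))))  (r2, m)"
      proof (rule wp_node_power[where u = l and c = q and y = ?y])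
        fix t4 r3
        assume t4: "t4 \<le> (2 * T + 12) * bits q + 5"
          and a3: "acc r3 (if False then rep q (str l) @ ?y else ?y @ rep q (str l))"
          and k3: "\<And>k. k < 30 \<Longrightarrow> k \<noteq> 8 \<Longrightarrow> r3 k = r2 k"
        have c3: "consts_ok r3" "r3 19 = u" "r3 26 = e"
          using k3 k2 c2 by (simp_all add: consts_ok_def u_def e_def)
        have t4': "t4 \<le> B + 5"
        proof -
          have "(2 * T + 12) * bits q \<le> (2 * T + 40) * (floor_log n + 1)" using q by (intro mult_le_mono) auto
          then show ?thesis using t4 B(1) by linarith
        qed
        have "wp W (Some H) (While 5 prefix_body)
          (\<lambda>t6. wp W (Some H) (Move 0 33) (\<lambda>t7. ?Q (11 + (t1 + ((1 + 1) + (t3 + (t4 + ((1 + 1) + (t6 + t7))))))))) (r3(2 := u, 5 := e), m)"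
        proof (rule wp_prefix_loop[OF V(2) _ _ V(4)])
          show "consts_ok (r3(2 := u, 5 := e))" "acc (r3(2 := u, 5 := e)) (?y @ rep q (str l))"
            using c3 a3 by (simp_all add: consts_ok_def acc_def)
          show "length (?y @ rep q (str l)) + e \<le> n" using len V by simp
          fix t6 r4
          assume t6: "t6 \<le> budget u + 1" and a4: "acc r4 ((?y @ rep q (str l)) @ take e (str u))"
          have "t3 \<le> B + 1" "t6 \<le> B + 1" using t3 t6 budget[OF V(1)] budget[OF V(2)] by linarith+
          \<comment> \<open>Range search, suffix, power and prefix take at most \<open>B + 5\<close>
            steps each; the constants are absorbed by three further copies of \<open>B\<close>,
            which is at least 40.\<close>
          then have "11 + (t1 + ((1 + 1) + (t3 + (t4 + ((1 + 1) + (t6 + 1)))))) \<le> 7 * B"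
            using t1' t4' B(3) by linarith
          moreover have "r4 33 = code (substring w i j)" using a4 by (simp add: acc_def eq)
          ultimately show "wp W (Some H) (Move 0 33) (\<lambda>t7. ?Q (11 + (t1 + ((1 + 1) + (t3 + (t4 + ((1 + 1) + (t6 + t7)))))))) (r4, m)"
            by (simp add: wp_simps)
        qed auto
        then show "wp W (Some H) (Seq (Move 2 19) (Move 5 26)) (\<lambda>t5. wp W (Some H) (While 5 prefix_body)
          (\<lambda>t6. wp W (Some H) (Move 0 33) (\<lambda>t7. ?Q (11 + (t1 + ((1 + 1) + (t3 + (t4 + (t5 + (t6 + t7)))))))))) (r3, m)"
          using c3 by (simp add: wp_Seq wp_Move add.assoc)
      qed (use V k2 c2 a2 len in \<open>auto simp: l_def q_def\<close>)
    qed auto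
    then show "wp W (Some H) (Seq (Move 2 12) (Move 5 17))
      (\<lambda>t2. wp W (Some H) (While 5 suffix_body) (\<lambda>t3. wp W (Some H) (node_power 12 18 False)
      (\<lambda>t4. wp W (Some H) (Seq (Move 2 19) (Move 5 26)) (\<lambda>t5. wp W (Some H) (While 5 prefix_body)
      (\<lambda>t6. wp W (Some H) (Move 0 33) (\<lambda>t7. ?Q (11 + (t1 + (t2 + (t3 + (t4 + (t5 + (t6 + t7))))))))))))) (r1, m)"
      by (simp add: wp_Seq wp_Move l_def a_def add.assoc)
  qed (use r0 root in auto)
  have "i < 2 ^ W" using ij w nW by linarith
  then have ev: "eval_op W Sub i (Suc 0) = s" unfolding s_def using ij by (subst eval_Sub) auto
  have W0: "W \<noteq> 0" using W by (cases W) auto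
  have c: "3 < (2::nat) ^ W" "2 < (2::nat) ^ W" "Suc 0 < 2 ^ W" using W by linarith+
  have "wp W (Some H) query_com ?Q (cells [i, j], m)"
    unfolding query_com_def wp_Seq[of _ _ init_com] init_com_def
    using main root(3) W0 W c ev cells unfolding r0_def
    by (simp add: wp_simps numeral_add_Suc add.assoc del: eval_op.simps(2))
  then show ?thesis unfolding B_def .
qed

end


section \<open>The index\<close>

text \<open>A leaf is its own child, so that every stored word is a legal address.\<close>

fun lkid :: "'a slp \<Rightarrow> 'a slp" where
  "lkid (Chr a) = Chr a"
| "lkid (App l r) = l"
| "lkid (Pow b k) = b"

fun rkid :: "'a slp \<Rightarrow> 'a slp" where
  "rkid (Chr a) = Chr a"
| "rkid (App l r) = r"
| "rkid (Pow b k) = b"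

text \<open>Splitting off the last copy gives a power the same shape, a power of the left child
  followed by the right child, as a concatenation. One record format and one descent thus serve
  both.\<close>

fun lcount :: "'a slp \<Rightarrow> nat" where
  "lcount (Chr a) = 0"
| "lcount (App l r) = 1"
| "lcount (Pow b k) = k - 1"

lemma lkid_subs: "u \<in> subs t \<Longrightarrow> lkid u \<in> subs t" and rkid_subs: "u \<in> subs t \<Longrightarrow> rkid u \<in> subs t"
  using kids_in_subs[of u t] by (cases u; auto)+

lemma yield_split:
  assumes "slp_ok u" "len u \<noteq> 1"
  shows "0 < lcount u" "yield u = rep (lcount u) (yield (lkid u)) @ yield (rkid u)"
    "lcount u * len (rkid u) \<le> len u" "height (lkid u) < height u" "height (rkid u) < height u"
proof -
  have *: "0 < lcount u \<and> yield u = rep (lcount u) (yield (lkid u)) @ yield (rkid u) \<and>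
    lcount u * len (rkid u) \<le> len u \<and> height (lkid u) < height u \<and> height (rkid u) < height u"
  proof (cases u)
    case (Pow b k)
    then have "2 < k" using assms by simp
    then have "rep k (yield b) = rep (k - 1) (yield b) @ rep 1 (yield b)"
      using rep_add[of "k - 1" 1 "yield b"] by simp
    then show ?thesis using Pow \<open>2 < k\<close> by simp
  qed (use assms in auto)
  then show "0 < lcount u" "yield u = rep (lcount u) (yield (lkid u)) @ yield (rkid u)"
    "lcount u * len (rkid u) \<le> len u" "height (lkid u) < height u" "height (rkid u) < height u"
    by blast+
qed

lemma lcount_le: "slp_ok u \<Longrightarrow> lcount u \<le> len u"
proof (cases u)
  case (Pow b k)
  assume "slp_ok u"
  then have "(k - 1) * 1 \<le> k * len b"
    using Pow len_pos[of b] by (intro mult_le_mono) (auto simp: Suc_le_eq)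
  then show ?thesis using Pow by simp
qed (auto simp: Suc_le_eq dest: len_pos)

lemma nth_concat_blocks:
  assumes "\<And>x. length (g x) = c" "i < length xs" "j < c"
  shows "concat (map g xs) ! (c * i + j) = g (xs ! i) ! j"
  using assms(2)
proof (induction xs arbitrary: i)
  case (Cons x xs)
  then show ?case using assms(1,3) by (cases i) (auto simp: nth_append)
qed simp

text \<open>Forces \<open>T\<close> to be at least 1, so that additive constants can be absorbed
  into multiples of \<open>T\<close>.\<close>

lemma exec_pos: "exec W sub c s t s' \<Longrightarrow> 0 < t"
  by (induction rule: exec.induct) auto

lemma index_ex:
  fixes t :: "'a slp" and f :: "'a list \<Rightarrow> 'b"
  assumes t: "slp_ok t" "yield t = w" "height t \<le> d"
    and "combination W enc (length w) f h H T"
    and W: "12 * length w < 2 ^ W" and enc: "\<And>x. enc (f x) < 2 ^ W"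
  shows "\<exists>ds. length ds = 5 * card (subs t) + 2 \<and> set ds \<subseteq> {..<2 ^ W} \<and>
    answers_queries W enc w f H query_com ds (7 * ((2 * T + 40) * (2 * d + floor_log (length w) + 1)))"
proof -
  interpret combination W enc "length w" f h H T by fact
  have wpos: "0 < length w" using len_pos[OF t(1)] t(2) by simp
  define N where "N = card (subs t)"
  have "card (subs t) \<le> 2 * length w - 1" using card_subs_le[OF t(1)] t(2) by simp
  \<comment> \<open>From \<open>N \<le> 2 * length w - 1\<close> it follows that the array has fewer
    than 12 times \<open>length w\<close> cells.\<close>
  then have NW: "5 * N + 2 < 2 ^ W" "N \<le> 2 * length w" using W wpos unfolding N_def by linarith+
  obtain \<phi> where \<phi>: "bij_betw \<phi> (subs t) {0..<N}"
    unfolding N_def using ex_bij_betw_finite_nat[OF finite_subs] by blast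
  define xs where "xs = map (inv_into (subs t) \<phi>) [0..<N]"
  have xs: "length xs = N" "\<And>u. u \<in> subs t \<Longrightarrow> \<phi> u < N \<and> xs ! \<phi> u = u" "set xs = subs t"
  proof -
    show "length xs = N" by (simp add: xs_def)
    show "\<phi> u < N \<and> xs ! \<phi> u = u" if "u \<in> subs t" for u
      using that \<phi> bij_betw_apply[OF \<phi> that] by (auto simp: xs_def bij_betw_def)
    show "set xs = subs t"
      using bij_betw_inv_into[OF \<phi>] by (simp add: xs_def bij_betw_def)
  qed
  \<comment> \<open>Five words per record, after the two header words.\<close>
  define ad where "ad u = 5 * \<phi> u + 2" for u
  define nd where "nd v = xs ! ((v - 2) div 5)" for v
  have nd_ad: "nd (ad u) = u" if "u \<in> subs t" for u
    using xs(2)[OF that] by (simp add: nd_def ad_def)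
  have ad_less: "ad u + 4 < 2 ^ W" if "u \<in> subs t" for u
    using xs(2)[OF that] NW(1) unfolding ad_def by linarith
  define g where "g u = [len u, code (yield u), ad (lkid u), ad (rkid u), lcount u]" for u
  define ds where "ds = ad t # code [] # concat (map g xs)"
  define m where "m = cells ds"
  have lds: "length ds = 5 * N + 2"
  proof -
    have "length (concat (map g ys)) = 5 * length ys" for ys by (induction ys) (auto simp: g_def)
    then show ?thesis using xs(1) by (simp add: ds_def)
  qed
  have m_block: "m (ad u + j) = g u ! j" if "u \<in> subs t" "j < 5" for u j
  proof -
    have "ad u + j < length ds" using xs(2)[OF that(1)] that(2) unfolding lds ad_def by linarith
    then have "m (ad u + j) = concat (map g xs) ! (5 * \<phi> u + j)"
      by (simp add: m_def cells_def ds_def ad_def)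
    also have "\<dots> = g u ! j"
      using nth_concat_blocks[of g 5 "\<phi> u" xs j] that xs by (simp add: g_def)
    finally show ?thesis .
  qed
  have m_node: "m (ad u) = len u" "m (ad u + 1) = code (yield u)" "m (ad u + 2) = ad (lkid u)"
    "m (ad u + 3) = ad (rkid u)" "m (ad u + 4) = lcount u" if "u \<in> subs t" for u
    using m_block[OF that, of 0] m_block[OF that, of 1] m_block[OF that, of 2]
      m_block[OF that, of 3] m_block[OF that, of 4] by (simp_all add: g_def)
  have len_le: "len u \<le> length w" if "u \<in> subs t" for u using len_subs[OF t(1) that] t(2) by simp
  have ok: "slp_ok u" if "u \<in> subs t" for u using slp_ok_subs[OF t(1) that] .
  interpret node_memory W enc "length w" f h H T "ad ` subs t" "yield \<circ> nd" "height \<circ> nd" m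
  proof
    fix v assume "v \<in> ad ` subs t"
    then obtain u where u: "u \<in> subs t" "v = ad u" by auto
    show "m v = length ((yield \<circ> nd) v) \<and> 0 < length ((yield \<circ> nd) v) \<and>
      length ((yield \<circ> nd) v) \<le> length w \<and> m (v + 1) = code ((yield \<circ> nd) v) \<and> v + 4 < 2 ^ W"
      using m_node(1,2)[OF u(1)] nd_ad[OF u(1)] ad_less[OF u(1)] len_le[OF u(1)] len_pos[OF ok[OF u(1)]]
      unfolding u(2) o_def by simp
    assume "length ((yield \<circ> nd) v) \<noteq> 1"
    then have "len u \<noteq> 1" using nd_ad[OF u(1)] u(2) by simp
    note ys = yield_split[OF ok[OF u(1)] this]
    show "m (v + 2) \<in> ad ` subs t \<and> m (v + 3) \<in> ad ` subs t \<and> 0 < m (v + 4) \<and>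
      (yield \<circ> nd) v = rep (m (v + 4)) ((yield \<circ> nd) (m (v + 2))) @ (yield \<circ> nd) (m (v + 3)) \<and>
      m (v + 4) * length ((yield \<circ> nd) (m (v + 3))) \<le> length ((yield \<circ> nd) v) \<and>
      (height \<circ> nd) (m (v + 2)) < (height \<circ> nd) v \<and> (height \<circ> nd) (m (v + 3)) < (height \<circ> nd) v"
      using ys lkid_subs[OF u(1)] rkid_subs[OF u(1)]
      unfolding u(2) m_node(3-5)[OF u(1)] o_def nd_ad[OF u(1)]
        nd_ad[OF lkid_subs[OF u(1)]] nd_ad[OF rkid_subs[OF u(1)]] by blast
  qed
  have m01: "m 0 = ad t" "m 1 = code []" by (simp_all add: m_def cells_def ds_def)
  have "\<exists>tm. real tm \<le> real (7 * ((2 * T + 40) * (2 * d + floor_log (length w) + 1))) \<and>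
      outputs W (Some H) query_com [i, j] ds tm (code (substring w i j))"
    if "1 \<le> i" "i \<le> j" "j \<le> length w" for i j
  proof -
    have "wp W (Some H) query_com
      (\<lambda>t s. t \<le> 7 * ((2 * T + 40) * (2 * d + floor_log (length w) + 1)) \<and> fst s 0 = code (substring w i j))
      (cells [i, j], m)"
    proof (rule wp_query_com[OF _ _ m01(2) _ that])
      show "m 0 \<in> ad ` subs t" "(yield \<circ> nd) (m 0) = w" using m01 nd_ad t(2) by simp_all
      fix v assume "v \<in> ad ` subs t"
      then obtain u where "u \<in> subs t" "v = ad u" by auto
      then show "(height \<circ> nd) v \<le> d"
        using nd_ad t(3) height_subs[of u t] by simp
    next
      show "4 < (2 :: nat) ^ W" using W wpos by linarith
    qed
    then show ?thesis unfolding wp_def outputs_def m_def by (metis of_nat_le_iff surjective_pairing)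
  qed
  moreover have "set ds \<subseteq> {..<2 ^ W}"
  proof -
    have "y < 2 ^ W" if "u \<in> subs t" "y \<in> set (g u)" for u y
    proof -
      have "len u < 2 ^ W" "lcount u < 2 ^ W"
        using len_le[OF that(1)] lcount_le[OF ok[OF that(1)]] nW by linarith+
      then show ?thesis
        using that(2) enc ad_less[OF lkid_subs[OF that(1)]] ad_less[OF rkid_subs[OF that(1)]]
        unfolding g_def by auto
    qed
    then show ?thesis using ad_less[of t] enc xs(3) unfolding ds_def by auto
  qed
  ultimately show ?thesis
    using lds unfolding answers_queries_def N_def by (intro exI[of _ ds]) simp
qed


text \<open>One program serves all strings and functions; an instance enters only through the array
  \<open>ds\<close> and the subroutine \<open>H\<close>.\<close>

theorem theorem5:
  fixes k :: nat
  shows "\<exists>c0 :: nat. \<forall>c1 :: nat. \<exists>(Q :: com) (C :: nat).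
    \<forall>(w :: 'a list) (n :: nat) (S :: 'b set) (f :: 'a list \<Rightarrow> 'b)
      (h :: 'b \<Rightarrow> 'b \<Rightarrow> nat \<Rightarrow> nat \<Rightarrow> 'b) (W :: nat) (enc :: 'b \<Rightarrow> nat) (H :: com) (T :: nat).
      n = length w \<and> n \<ge> 1 \<and>
      finite S \<and> card S \<le> n ^ k \<and> (\<forall>x. f x \<in> S) \<and>
      (\<forall>x y. f (x @ y) = h (f x) (f y) (length x) (length y)) \<and>
      c0 * lg n \<le> W \<and> W \<le> c1 * lg n \<and>
      inj_on enc S \<and> enc ` S \<subseteq> {..<2 ^ W} \<and>
      computes_combination W enc n f h H T
      \<longrightarrow> (\<exists>ds :: nat list. length ds \<le> C * g_rl w \<and> set ds \<subseteq> {..<2 ^ W} \<and>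
            answers_queries W enc w f H Q ds (C * T * lg n))"
proof (rule exI[of _ "10 :: nat"], rule allI, rule exI[of _ query_com], rule exI[of _ "21756 :: nat"],
    intro allI impI, elim conjE)
  fix c1 :: nat and w :: "'a list" and n :: nat and S :: "'b set" and f :: "'a list \<Rightarrow> 'b"
    and h :: "'b \<Rightarrow> 'b \<Rightarrow> nat \<Rightarrow> nat \<Rightarrow> 'b" and W :: nat and enc :: "'b \<Rightarrow> nat" and H :: com and T :: nat
  assume n: "n = length w" "1 \<le> n" and f: "\<forall>x. f x \<in> S"
    and hom: "\<forall>x y. f (x @ y) = h (f x) (f y) (length x) (length y)"
    and W: "real 10 * lg n \<le> real W" and enc: "enc ` S \<subseteq> {..<2 ^ W}"
    and comp: "computes_combination W enc n f h H T"
  have lg: "1 \<le> lg n" "log 2 (real n) \<le> lg n" by (simp_all add: lg_def)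
  \<comment> \<open>As \<open>lg n\<close> is at least 1, ten times it is at least 9 plus the
    logarithm of \<open>n\<close>, so a word exceeds every address and length by a wide
    margin.\<close>
  have "2 powr (9 + log 2 (real n)) \<le> 2 powr real W"
    using W lg by (intro powr_mono) auto
  then have "512 * real n \<le> real (2 ^ W)"
    using n(2) by (simp add: powr_add powr_realpow)
  then have nW: "512 * n \<le> 2 ^ W"
    by (metis of_nat_le_iff of_nat_mult of_nat_numeral)
  have "w \<noteq> []" using n by auto
  then obtain t0 where t0: "yield t0 = w" "slp_ok t0" "card (subs t0) \<le> g_rl w"
    by (rule g_rl_tree_ex)
  interpret balancing t0 using t0(2) by unfold_locales
  obtain t where t: "yield t = w" "slp_ok t" "card (subs t) \<le> 6 * card (subs t0)"
    "height t \<le> 30 * floor_log n + 6"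
    using balanced_tree_ex t0(1) n(1) by metis
  have "combination W enc (length w) f h H T"
    using comp hom nW n unfolding combination_def by auto
  moreover have "12 * length w < 2 ^ W" using nW n by linarith
  moreover have "enc (f x) < 2 ^ W" for x using enc f by auto
  ultimately obtain ds where ds: "length ds = 5 * card (subs t) + 2" "set ds \<subseteq> {..<2 ^ W}"
    "answers_queries W enc w f H query_com ds
      (7 * ((2 * T + 40) * (2 * (30 * floor_log n + 6) + floor_log (length w) + 1)))"
    using index_ex[OF t(2,1,4)] by blast
  have "0 < card (subs t0)" by (auto simp: card_gt_0_iff intro: subs_self)
  then have size: "length ds \<le> 21756 * g_rl w" using ds(1) t(3) t0(3) by linarith
  have T: "1 \<le> T"
    using comp exec_pos unfolding computes_combination_def outputs_def
    by (metis add_0 le0 le_trans list.size(3) Suc_leI One_nat_def)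
  have "real (floor_log n) \<le> log 2 (real n)"
    using n(2) by (simp add: floor_log_altdef)
  then have "real (2 * (30 * floor_log n + 6) + floor_log (length w) + 1) \<le> 74 * lg n"
    using lg n(1) by simp
  \<comment> \<open>The factor 42 is 2 + 40, using that \<open>T\<close> is at least 1, and 74 is 2
    * 30 + 2 * 6 + 1 + 1. With the 7 of the query this gives 7 * 42 * 74 = 21756, which also exceeds
    the 32 words per unit of grammar size.\<close>
  then have "real (2 * T + 40) * real (2 * (30 * floor_log n + 6) + floor_log (length w) + 1)
      \<le> (42 * real T) * (74 * lg n)"
    using T by (intro mult_mono) auto
  then have "real (7 * ((2 * T + 40) * (2 * (30 * floor_log n + 6) + floor_log (length w) + 1)))
      \<le> real (21756 * T) * lg n"
    by (simp only: of_nat_mult)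
  then have "answers_queries W enc w f H query_com ds (real (21756 * T) * lg n)"
    using ds(3) unfolding answers_queries_def by (meson order_trans)
  then show "\<exists>ds. length ds \<le> 21756 * g_rl w \<and> set ds \<subseteq> {..<2 ^ W} \<and>
      answers_queries W enc w f H query_com ds (real (21756 * T) * lg n)"
    using size ds(2) by blast
qed

end
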